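(* Let $S$ be a finite non-empty set with $|S|=n$, let $f\colon 2^S\to[0,\infty)$ be non-decreasing and submodular with $f(\emptyset)=0$ and $f(A)>0$ for all $A\neq\emptyset$, and let $g\colon 2^S\to[0,\infty)$ be non-decreasing and supermodular with $g(\emptyset)=0$ and $g(A)<g(S)$ for all $A\neq S$. Suppose that $f$ and $g$ are given by value oracles. Then there is a $2$-approximation for an optimal search strategy to the submodular search problem (i.e. a search $\pi$ with $c(\pi)\le 2\min_{\sigma}c(\sigma)$) that can be computed in strongly polynomial time.
   Context: A search is a permutation $\pi$ of $S$. For $j\in S$, $S_j^\pi$ is the set consisting of $j$ and all elements preceding $j$ in $\pi$. The submodular search problem is to find a search minimizing $c(\pi)=\sum_{j\in S}\bigl(g(S_j^\pi)-g(S_j^\pi\setminus\{j\})\bigr)f(S_j^\pi)$. Strongly polynomial time means that the number of oracle calls and elementary arithmetic operations is bounded by a polynomial in $n$. *)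

theory Defs
  imports Complex_Main "HOL-Combinatorics.Multiset_Permutations"
    "HOL-Computational_Algebra.Polynomial"
begin

section \<open>The submodular search problem\<close>

text \<open>Set functions on the subsets of \<^term>\<open>S\<close> are total functions whose values outside
  \<^term>\<open>Pow S\<close> are irrelevant.\<close>

definition submodular_on :: "'a set \<Rightarrow> ('a set \<Rightarrow> real) \<Rightarrow> bool" where
  "submodular_on S f \<longleftrightarrow>
     (\<forall>A B. A \<subseteq> S \<longrightarrow> B \<subseteq> S \<longrightarrow> f (A \<union> B) + f (A \<inter> B) \<le> f A + f B)"

definition supermodular_on :: "'a set \<Rightarrow> ('a set \<Rightarrow> real) \<Rightarrow> bool" where
  "supermodular_on S g \<longleftrightarrow>
     (\<forall>A B. A \<subseteq> S \<longrightarrow> B \<subseteq> S \<longrightarrow> g A + g B \<le> g (A \<union> B) + g (A \<inter> B))"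

text \<open>A search of \<^term>\<open>S\<close> is an element of \<^term>\<open>permutations_of_set S\<close>, that is, a list in
  which every element of \<^term>\<open>S\<close> occurs exactly once, in the order in which the elements are
  searched.\<close>

definition searched :: "'a list \<Rightarrow> 'a \<Rightarrow> 'a set" where
  "searched \<pi> j = insert j (set (takeWhile (\<lambda>i. i \<noteq> j) \<pi>))"

definition search_cost ::
    "'a set \<Rightarrow> ('a set \<Rightarrow> real) \<Rightarrow> ('a set \<Rightarrow> real) \<Rightarrow> 'a list \<Rightarrow> real" where
  "search_cost S f g \<pi> =
     (\<Sum>j\<in>S. (g (searched \<pi> j) - g (searched \<pi> j - {j})) * f (searched \<pi> j))"


section \<open>Algorithms with value oracles over the reals\<close>

text \<open>
  Strongly polynomial time is stated for a small imperative language with two kinds of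
  arrays (of arbitrary dimension; a scalar is an array accessed with the empty index list):
  index arrays holding natural numbers and real arrays holding exact real numbers.

  \<^item> Real numbers admit only the constants 0 and 1, the four field operations and comparison.
    There is no rounding and no conversion to indices. Arbitrary real constants are excluded
    since they could carry advice.
  \<^item> Indices admit addition, truncated subtraction and comparison, but no multiplication:
    numbers computed in \<open>t\<close> steps then have \<open>O(t)\<close> bits, so that unit-cost index
    arithmetic gives no more than ordinary polynomial-time computation.
  \<^item> Division by zero yields zero.
\<close>

type_synonym vname = string

datatype iexp =
    IConst nat
  | IVar vname "iexp list"
  | IAdd iexp iexp
  | ISub iexp iexp

datatype rexp =
    RZero
  | ROne
  | RVar vname "iexp list"
  | RAdd rexp rexp
  | RSub rexp rexp
  | RMul rexp rexp
  | RDiv rexp rexp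

datatype bexp =
    ILess iexp iexp
  | RLess rexp rexp
  | BNot bexp
  | BAnd bexp bexp

datatype ora_name = Oracle_f | Oracle_g

text \<open>\<open>Query q x is a js\<close> stores in \<open>x[is]\<close> the value of the set function named \<open>q\<close> on the set whose
  characteristic vector is the row \<open>a[js, 0], \<dots>, a[js, n - 1]\<close> of an index array
  (nonzero entries are members).\<close>

datatype com =
    Skip
  | IAssign vname "iexp list" iexp
  | RAssign vname "iexp list" rexp
  | Query ora_name vname "iexp list" vname "iexp list"
  | Seq com com
  | Cond bexp com com
  | While bexp com

record state =
  imem :: "vname \<Rightarrow> nat list \<Rightarrow> nat"
  rmem :: "vname \<Rightarrow> nat list \<Rightarrow> real"

fun ival :: "state \<Rightarrow> iexp \<Rightarrow> nat" where
  "ival s (IConst k) = k"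
| "ival s (IVar x es) = imem s x (map (ival s) es)"
| "ival s (IAdd e e') = ival s e + ival s e'"
| "ival s (ISub e e') = ival s e - ival s e'"

fun rval :: "state \<Rightarrow> rexp \<Rightarrow> real" where
  "rval s RZero = 0"
| "rval s ROne = 1"
| "rval s (RVar x es) = rmem s x (map (ival s) es)"
| "rval s (RAdd e e') = rval s e + rval s e'"
| "rval s (RSub e e') = rval s e - rval s e'"
| "rval s (RMul e e') = rval s e * rval s e'"
| "rval s (RDiv e e') = rval s e / rval s e'"

fun bval :: "state \<Rightarrow> bexp \<Rightarrow> bool" where
  "bval s (ILess e e') \<longleftrightarrow> ival s e < ival s e'"
| "bval s (RLess e e') \<longleftrightarrow> rval s e < rval s e'"
| "bval s (BNot b) \<longleftrightarrow> \<not> bval s b"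
| "bval s (BAnd b b') \<longleftrightarrow> bval s b \<and> bval s b'"

text \<open>Every constant, memory access, arithmetic operation, comparison and Boolean operation
  costs one unit.\<close>

fun icost :: "iexp \<Rightarrow> nat" where
  "icost (IConst k) = 1"
| "icost (IVar x es) = 1 + sum_list (map icost es)"
| "icost (IAdd e e') = 1 + icost e + icost e'"
| "icost (ISub e e') = 1 + icost e + icost e'"

fun rcost :: "rexp \<Rightarrow> nat" where
  "rcost RZero = 1"
| "rcost ROne = 1"
| "rcost (RVar x es) = 1 + sum_list (map icost es)"
| "rcost (RAdd e e') = 1 + rcost e + rcost e'"
| "rcost (RSub e e') = 1 + rcost e + rcost e'"
| "rcost (RMul e e') = 1 + rcost e + rcost e'"
| "rcost (RDiv e e') = 1 + rcost e + rcost e'"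

fun bcost :: "bexp \<Rightarrow> nat" where
  "bcost (ILess e e') = 1 + icost e + icost e'"
| "bcost (RLess e e') = 1 + rcost e + rcost e'"
| "bcost (BNot b) = 1 + bcost b"
| "bcost (BAnd b b') = 1 + bcost b + bcost b'"

definition iupd :: "vname \<Rightarrow> nat list \<Rightarrow> nat \<Rightarrow> state \<Rightarrow> state" where
  "iupd x is v s = s\<lparr>imem := (imem s)(x := (imem s x)(is := v))\<rparr>"

definition rupd :: "vname \<Rightarrow> nat list \<Rightarrow> real \<Rightarrow> state \<Rightarrow> state" where
  "rupd x is v s = s\<lparr>rmem := (rmem s)(x := (rmem s x)(is := v))\<rparr>"

text \<open>\<open>exec n ora c s t s'\<close>: with oracles \<open>ora\<close> for set functions on \<open>{..<n}\<close>, command \<open>c\<close>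
  started in state \<open>s\<close> terminates in state \<open>s'\<close> at total cost \<open>t\<close>. A query has unit
  cost, apart from the evaluation of the addresses.\<close>

inductive exec ::
    "nat \<Rightarrow> (ora_name \<Rightarrow> nat set \<Rightarrow> real) \<Rightarrow> com \<Rightarrow> state \<Rightarrow> nat \<Rightarrow> state \<Rightarrow> bool"
  for n :: nat and ora :: "ora_name \<Rightarrow> nat set \<Rightarrow> real" where
  Skip: "exec n ora Skip s 1 s"
| IAssign: "exec n ora (IAssign x es e) s (1 + sum_list (map icost es) + icost e)
     (iupd x (map (ival s) es) (ival s e) s)"
| RAssign: "exec n ora (RAssign x es e) s (1 + sum_list (map icost es) + rcost e)
     (rupd x (map (ival s) es) (rval s e) s)"
| Query: "exec n ora (Query q x es a es') s
     (1 + sum_list (map icost es) + sum_list (map icost es'))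
     (rupd x (map (ival s) es)
       (ora q {k. k < n \<and> imem s a (map (ival s) es' @ [k]) \<noteq> 0}) s)"
| Seq: "exec n ora c s t s' \<Longrightarrow> exec n ora c' s' t' s'' \<Longrightarrow>
     exec n ora (Seq c c') s (t + t') s''"
| CondTrue: "bval s b \<Longrightarrow> exec n ora c s t s' \<Longrightarrow>
     exec n ora (Cond b c c') s (1 + bcost b + t) s'"
| CondFalse: "\<not> bval s b \<Longrightarrow> exec n ora c' s t s' \<Longrightarrow>
     exec n ora (Cond b c c') s (1 + bcost b + t) s'"
| WhileFalse: "\<not> bval s b \<Longrightarrow> exec n ora (While b c) s (1 + bcost b) s"
| WhileTrue: "bval s b \<Longrightarrow> exec n ora c s t s' \<Longrightarrow> exec n ora (While b c) s' t' s'' \<Longrightarrow>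
     exec n ora (While b c) s (1 + bcost b + t + t') s''"

inductive_cases SkipE: "exec n ora Skip s t s'"
inductive_cases IAssignE: "exec n ora (IAssign x es e) s t s'"
inductive_cases RAssignE: "exec n ora (RAssign x es e) s t s'"
inductive_cases QueryE: "exec n ora (Query q x es a es') s t s'"
inductive_cases SeqE: "exec n ora (Seq c c') s t s'"
inductive_cases CondE: "exec n ora (Cond b c c') s t s'"
inductive_cases WhileE: "exec n ora (While b c) s t s'"

lemma exec_deterministic:
  "exec n ora c s t s' \<Longrightarrow> exec n ora c s u r' \<Longrightarrow> t = u \<and> s' = r'"
proof (induction arbitrary: u r' rule: exec.induct)
  case Skip
  then show ?case by (auto elim: SkipE)
next
  case IAssign
  then show ?case by (auto elim: IAssignE)
next
  case RAssign
  then show ?case by (auto elim: RAssignE)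
next
  case Query
  then show ?case by (auto elim: QueryE)
next
  case (Seq c s t s' c' t' s'')
  from Seq.prems obtain u1 u2 r where "exec n ora c s u1 r" "exec n ora c' r u2 r'" "u = u1 + u2"
    by (rule SeqE)
  with Seq.IH show ?case by metis
next
  case (CondTrue s b c t s' c')
  from CondTrue.prems \<open>bval s b\<close> obtain u1 where "exec n ora c s u1 r'" "u = 1 + bcost b + u1"
    by (auto elim: CondE)
  with CondTrue.IH show ?case by metis
next
  case (CondFalse s b c' t s' c)
  from CondFalse.prems \<open>\<not> bval s b\<close> obtain u1 where "exec n ora c' s u1 r'" "u = 1 + bcost b + u1"
    by (auto elim: CondE)
  with CondFalse.IH show ?case by metis
next
  case (WhileFalse s b c)
  from WhileFalse.prems show ?case by (rule WhileE) (use WhileFalse.hyps in simp_all)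
next
  case (WhileTrue s b c t s' t' s'')
  from WhileTrue.prems \<open>bval s b\<close> obtain u1 r u2 where "u = 1 + bcost b + u1 + u2"
    "exec n ora c s u1 r" "exec n ora (While b c) r u2 r'"
    by cases auto
  with WhileTrue.IH show ?case by metis
qed

text \<open>The only input read from memory is the scalar \<open>n\<close>.\<close>

definition init_state :: "nat \<Rightarrow> state" where
  "init_state n = \<lparr>imem = (\<lambda>x is. if x = ''n'' \<and> is = [] then n else 0), rmem = (\<lambda>x is. 0)\<rparr>"

text \<open>The algorithm handles the ground set through an enumeration \<open>xs\<close> of its elements; position
  \<open>k\<close> stands for the element \<open>xs ! k\<close>.\<close>

definition ora_of ::
    "'a list \<Rightarrow> ('a set \<Rightarrow> real) \<Rightarrow> ('a set \<Rightarrow> real) \<Rightarrow> ora_name \<Rightarrow> nat set \<Rightarrow> real" where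
  "ora_of xs f g q K = (case q of Oracle_f \<Rightarrow> f ((!) xs ` K) | Oracle_g \<Rightarrow> g ((!) xs ` K))"

text \<open>The run of program \<open>P\<close> takes time \<open>t\<close> and leaves the positions of the elements of \<open>\<pi>\<close> in
  \<open>out[0], \<dots>, out[n - 1]\<close>. The requirement that these positions are below \<open>n\<close> keeps \<open>(!)\<close> from
  being applied out of range.\<close>

definition computes_in_time ::
    "com \<Rightarrow> 'a list \<Rightarrow> ('a set \<Rightarrow> real) \<Rightarrow> ('a set \<Rightarrow> real) \<Rightarrow> nat \<Rightarrow> 'a list \<Rightarrow> bool" where
  "computes_in_time P xs f g t \<pi> \<longleftrightarrow>
     (\<exists>s. exec (length xs) (ora_of xs f g) P (init_state (length xs)) t s \<and>
          (\<forall>k<length xs. imem s ''out'' [k] < length xs) \<and>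
          \<pi> = map (\<lambda>k. xs ! imem s ''out'' [k]) [0..<length xs])"

end

theory Submission
  imports Defs "HOL-Analysis.Convex"
begin

text \<open>
  Let \<open>g'\<close> be the dual \<open>A \<mapsto> g S - g (S - A)\<close> of \<open>g\<close>. If \<open>p\<close> and \<open>w\<close> lie in the polymatroids of \<open>f\<close>
  and \<open>g'\<close>, then twice the cost of any search is at least
  \<open>\<Sum>i. p i * w i + \<Sum>i j. min (p i * w j) (p j * w i)\<close> (Smith's rule). Exact submodular minimisation
  would give \<open>p\<close>, \<open>w\<close> and a search matching this bound up to the first sum. That first sum leaves
  a relative slack of \<open>1 / n\<close>, which makes it enough to solve a scale-invariant problem approximately:
  maximise the concave potential \<open>H = \<Sum>i. sqrt (p i * w i)\<close>, whose square is at most \<open>n\<close> times the slack.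

  The gradient of \<open>H\<close> in \<open>p\<close> is ordered by \<open>w i / p i\<close> and its gradient in \<open>w\<close> by \<open>p i / w i\<close>, so a single
  search \<open>\<pi>\<close> with \<open>w i / p i\<close> decreasing yields the greedy maximiser in both polymatroids.
  If the first-order gap at \<open>(p, w)\<close> is at most \<open>H / (32 n^2)\<close>, then \<open>\<pi>\<close> costs at most the
  lower bound above. Otherwise a conditional-gradient step of fixed length multiplies \<open>H\<close> by
  \<open>1 + 1 / (2^24 n^7)\<close>. Since \<open>H\<close> is initially within a factor \<open>n\<close> of its maximum, one of the first
  \<open>2^24 n^8\<close> searches is a 2-approximation, and the program outputs the cheapest of them.
\<close>

section \<open>Greedy vertices and the cost of a search\<close>

text \<open>For submodular \<open>f\<close> the vector \<open>gain f \<pi>\<close> is the greedy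
  vertex of its polymatroid in the order \<open>\<pi>\<close>; the marginal
  \<open>gain g \<pi> j\<close> is also the weight of \<open>j\<close> in the search cost.\<close>

definition gain :: "('a set \<Rightarrow> real) \<Rightarrow> 'a list \<Rightarrow> 'a \<Rightarrow> real" where
  "gain f \<pi> j = f (searched \<pi> j) - f (searched \<pi> j - {j})"

text \<open>Membership in the extended polymatroid of \<open>f\<close>; signs of the coordinates are
  controlled separately, by lower bounds.\<close>

definition independent :: "'a set \<Rightarrow> ('a set \<Rightarrow> real) \<Rightarrow> ('a \<Rightarrow> real) \<Rightarrow> bool" where
  "independent S f p \<longleftrightarrow> (\<forall>A. A \<subseteq> S \<longrightarrow> sum p A \<le> f A)"

definition dual :: "'a set \<Rightarrow> ('a set \<Rightarrow> real) \<Rightarrow> 'a set \<Rightarrow> real" where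
  "dual S g A = g S - g (S - A)"

definition potential :: "'a set \<Rightarrow> ('a \<Rightarrow> real) \<Rightarrow> ('a \<Rightarrow> real) \<Rightarrow> real" where
  "potential S p w = (\<Sum>i\<in>S. sqrt (p i * w i))"

section \<open>Prefixes of a search and of its reverse\<close>

lemma searched_append: "j \<in> set xs \<Longrightarrow> searched (xs @ ys) j = searched xs j"
  by (simp add: searched_def)

lemma searched_split: "j \<notin> set ys \<Longrightarrow> searched (ys @ j # zs) j = insert j (set ys)"
  unfolding searched_def by (subst takeWhile_append2) auto

lemma searched_snoc: "j \<notin> set ys \<Longrightarrow> searched (ys @ [j]) j = insert j (set ys)"
  by (rule searched_split)

lemma gain_append: "j \<in> set xs \<Longrightarrow> gain f (xs @ ys) j = gain f xs j"
  by (simp add: gain_def searched_append)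

lemma gain_snoc: "j \<notin> set xs \<Longrightarrow> gain f (xs @ [j]) j = f (insert j (set xs)) - f (set xs)"
  by (simp add: gain_def searched_snoc)

lemma searched_subset: "j \<in> set \<pi> \<Longrightarrow> searched \<pi> j \<subseteq> set \<pi>"
  by (auto simp: searched_def dest: set_takeWhileD)

text \<open>Both sides say that \<open>i\<close> does not come after \<open>j\<close> in
  \<open>\<pi>\<close>; comparing the splittings of \<open>\<pi>\<close> at \<open>i\<close> and at
  \<open>j\<close> shows it. This is what permits exchanging double sums over prefixes.\<close>

lemma searched_rev:
  assumes "distinct \<pi>" "i \<in> set \<pi>" "j \<in> set \<pi>"
  shows "i \<in> searched \<pi> j \<longleftrightarrow> j \<in> searched (rev \<pi>) i"
proof -
  obtain ys zs where j: "\<pi> = ys @ j # zs" using assms(3) split_list by metis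
  obtain us vs where i: "\<pi> = us @ i # vs" using assms(2) split_list by metis
  have 1: "searched \<pi> j = insert j (set ys)" using assms(1) unfolding j by (intro searched_split) auto
  have 2: "rev \<pi> = rev vs @ i # rev us" using i by simp
  have 3: "searched (rev \<pi>) i = insert i (set vs)"
    unfolding 2 using assms(1) i searched_split[of i "rev vs" "rev us"] by auto
  have eq: "ys @ j # zs = us @ i # vs" using i j by simp
  have d: "distinct (ys @ j # zs)" "distinct (us @ i # vs)" using assms(1) i j by auto
  have "i \<in> insert j (set ys) \<longleftrightarrow> j \<in> insert i (set vs)"
  proof (cases "i = j")
    case False
    show ?thesis
      using eq d False by (auto simp: append_eq_append_conv2 append_eq_Cons_conv Cons_eq_append_conv)
  qed simp
  then show ?thesis using 1 3 by simp
qed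

lemma searched_rev_compl:
  assumes "distinct \<pi>" "j \<in> set \<pi>"
  shows "set \<pi> - searched (rev \<pi>) j = searched \<pi> j - {j}"
proof -
  obtain ys zs where j: "\<pi> = ys @ j # zs" using assms(2) split_list by metis
  have 1: "searched \<pi> j = insert j (set ys)" using assms(1) unfolding j by (intro searched_split) auto
  have 3: "searched (rev \<pi>) j = insert j (set zs)"
    using assms(1) j searched_split[of j "rev zs" "rev ys"] by auto
  show ?thesis using 1 3 assms(1) j by auto
qed

text \<open>Complements of prefixes of \<open>rev \<pi>\<close> are prefixes of
  \<open>\<pi>\<close>, so the increments of the dual along \<open>rev \<pi>\<close> are those of
  \<open>g\<close> along \<open>\<pi>\<close>. Hence a single search gives greedy vertices of both
  polymatroids, in opposite orders.\<close>

lemma gain_dual: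
  assumes "distinct \<pi>" "j \<in> set \<pi>"
  shows "gain (dual (set \<pi>) g) (rev \<pi>) j = gain g \<pi> j"
proof -
  have a: "set \<pi> - (searched (rev \<pi>) j - {j}) = searched \<pi> j"
  proof -
    have "set \<pi> - (searched (rev \<pi>) j - {j}) = insert j (set \<pi> - searched (rev \<pi>) j)"
      using assms(2) by auto
    also have "\<dots> = searched \<pi> j" using searched_rev_compl[OF assms] by (auto simp: searched_def)
    finally show ?thesis .
  qed
  show ?thesis unfolding gain_def dual_def a searched_rev_compl[OF assms] by simp
qed

section \<open>The greedy algorithm for polymatroids\<close>

lemma sum_gain:
  "distinct xs \<Longrightarrow> f {} = 0 \<Longrightarrow> sum (gain f xs) (set xs) = f (set xs)"
proof (induction xs rule: rev_induct)
  case (snoc x xs)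
  have "sum (gain f (xs @ [x])) (set xs) = sum (gain f xs) (set xs)"
    by (intro sum.cong) (auto simp: gain_append)
  then show ?case using snoc by (simp add: gain_snoc)
qed simp

lemma sum_gain_searched:
  assumes "distinct \<pi>" "f {} = 0" "j \<in> set \<pi>"
  shows "sum (gain f \<pi>) (searched \<pi> j) = f (searched \<pi> j)"
proof -
  obtain ys zs where j: "\<pi> = ys @ j # zs" using assms(3) split_list by metis
  have 1: "searched \<pi> j = set (ys @ [j])" using assms(1) unfolding j by (subst searched_split) auto
  have "sum (gain f \<pi>) (set (ys @ [j])) = sum (gain f (ys @ [j])) (set (ys @ [j]))"
    using gain_append[of _ "ys @ [j]" f zs] j by (intro sum.cong) auto
  also have "\<dots> = f (set (ys @ [j]))" using assms j by (intro sum_gain) auto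
  finally show ?thesis unfolding 1 .
qed

lemma gain_nonneg:
  assumes "mono_on (Pow S) f" "set \<pi> \<subseteq> S" "j \<in> set \<pi>"
  shows "0 \<le> gain f \<pi> j"
  using assms searched_subset[OF assms(3)] unfolding gain_def
  by (auto intro!: mono_onD[OF assms(1)])

text \<open>Edmonds' greedy argument, by induction on the prefix: if the last element
  \<open>x\<close> lies in \<open>A\<close>, submodularity for \<open>A\<close> and the prefix
  \<open>set xs\<close> bounds the last marginal by \<open>f A - f (A - {x})\<close>.\<close>

lemma gain_independent:
  assumes "submodular_on S f" "f {} = 0"
  shows "distinct xs \<Longrightarrow> set xs \<subseteq> S \<Longrightarrow> independent (set xs) f (gain f xs)"
proof (induction xs rule: rev_induct)
  case Nil
  then show ?case using assms(2) by (simp add: independent_def)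
next
  case (snoc x xs)
  show ?case unfolding independent_def
  proof (intro allI impI)
    fix A assume A: "A \<subseteq> set (xs @ [x])"
    have fin: "finite A" using A finite_subset by blast
    have B: "A - {x} \<subseteq> set xs" using A by auto
    have "sum (gain f (xs @ [x])) (A - {x}) = sum (gain f xs) (A - {x})"
      using B by (intro sum.cong) (auto simp: gain_append)
    also have "\<dots> \<le> f (A - {x})" using snoc B by (auto simp: independent_def)
    finally have le: "sum (gain f (xs @ [x])) (A - {x}) \<le> f (A - {x})" .
    show "sum (gain f (xs @ [x])) A \<le> f A"
    proof (cases "x \<in> A")
      case True
      have e: "A \<union> set xs = insert x (set xs)" "A \<inter> set xs = A - {x}"
        using True A snoc.prems by auto
      have "A \<subseteq> S" "set xs \<subseteq> S" using A snoc.prems by auto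
      then have "f (A \<union> set xs) + f (A \<inter> set xs) \<le> f A + f (set xs)"
        using assms(1) unfolding submodular_on_def by blast
      then have "f (insert x (set xs)) - f (set xs) \<le> f A - f (A - {x})"
        unfolding e by simp
      moreover have "sum (gain f (xs @ [x])) A
          = gain f (xs @ [x]) x + sum (gain f (xs @ [x])) (A - {x})"
        using True fin by (simp add: sum.remove)
      ultimately show ?thesis using le snoc.prems by (simp add: gain_snoc)
    next
      case False
      then show ?thesis using le by simp
    qed
  qed
qed

text \<open>Abel summation in inductive form. The slack of \<open>p\<close> on the current prefix is
  weighted by a lower bound \<open>c\<close> of all its weights; since the weights decrease, the
  induction hypothesis for the shorter prefix may be used with \<open>c\<close> raised to the last
  weight \<open>z x\<close>.\<close>

lemma gain_maximal_aux:
  assumes "independent S f p" "f {} = 0"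
  shows "distinct xs \<Longrightarrow> set xs \<subseteq> S \<Longrightarrow> sorted_wrt (\<lambda>i j. z i \<ge> z j) xs \<Longrightarrow>
    0 \<le> c \<Longrightarrow> (\<forall>j\<in>set xs. c \<le> z j) \<Longrightarrow>
    c * (f (set xs) - sum p (set xs)) \<le> (\<Sum>j\<in>set xs. z j * (gain f xs j - p j))"
proof (induction xs arbitrary: c rule: rev_induct)
  case Nil
  then show ?case using assms(2) by simp
next
  case (snoc x xs)
  have zx: "c \<le> z x" using snoc.prems by simp
  have IH: "z x * (f (set xs) - sum p (set xs)) \<le> (\<Sum>j\<in>set xs. z j * (gain f xs j - p j))"
    using snoc by (auto simp: sorted_wrt_append)
  have "(\<Sum>j\<in>set xs. z j * (gain f (xs @ [x]) j - p j)) = (\<Sum>j\<in>set xs. z j * (gain f xs j - p j))"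
    by (intro sum.cong) (auto simp: gain_append)
  then have eq: "(\<Sum>j\<in>set (xs @ [x]). z j * (gain f (xs @ [x]) j - p j))
    = z x * (f (insert x (set xs)) - f (set xs) - p x) + (\<Sum>j\<in>set xs. z j * (gain f xs j - p j))"
    using snoc.prems by (simp add: gain_snoc)
  have "sum p (set (xs @ [x])) \<le> f (set (xs @ [x]))"
    using assms(1) snoc.prems unfolding independent_def by blast
  then have "c * (f (set (xs @ [x])) - sum p (set (xs @ [x])))
      \<le> z x * (f (set (xs @ [x])) - sum p (set (xs @ [x])))"
    using zx by (intro mult_right_mono) auto
  also have "\<dots> = z x * (f (insert x (set xs)) - f (set xs) - p x)
      + z x * (f (set xs) - sum p (set xs))"
    using snoc.prems by (simp add: algebra_simps)
  finally show ?case using IH eq by simp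
qed

lemma gain_maximal:
  assumes "independent (set xs) f p" "f {} = 0" "distinct xs"
    "sorted_wrt (\<lambda>i j. z i \<ge> z j) xs" "\<forall>j\<in>set xs. 0 \<le> z j"
  shows "(\<Sum>j\<in>set xs. z j * p j) \<le> (\<Sum>j\<in>set xs. z j * gain f xs j)"
  using gain_maximal_aux[of "set xs" f p xs z 0] assms
  by (simp add: algebra_simps sum_subtractf)

lemma independent_nonneg_le:
  assumes "independent S f p" "j \<in> S"
  shows "p j \<le> f {j}"
  using assms unfolding independent_def by (metis empty_subsetI insert_subset sum.insert sum.empty
    finite.emptyI empty_iff add.right_neutral)

lemma submodular_dual:
  assumes "supermodular_on S g"
  shows "submodular_on S (dual S g)"
  unfolding submodular_on_def
proof (intro allI impI)
  fix A B assume "A \<subseteq> S" "B \<subseteq> S"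
  have "g (S - A) + g (S - B) \<le> g ((S - A) \<union> (S - B)) + g ((S - A) \<inter> (S - B))"
    using assms unfolding supermodular_on_def by blast
  moreover have "(S - A) \<union> (S - B) = S - A \<inter> B" "(S - A) \<inter> (S - B) = S - (A \<union> B)" by auto
  ultimately show "dual S g (A \<union> B) + dual S g (A \<inter> B) \<le> dual S g A + dual S g B"
    unfolding dual_def by simp
qed

lemma mono_dual: "mono_on (Pow S) g \<Longrightarrow> mono_on (Pow S) (dual S g)"
  unfolding dual_def by (auto intro!: mono_onI mono_onD[of "Pow S" g])

lemma independent_combination:
  assumes "independent S f p" "independent S f q" "0 \<le> a" "0 \<le> b" "a + b = 1"
  shows "independent S f (\<lambda>i. a * p i + b * q i)"
  unfolding independent_def
proof (intro allI impI)
  fix A assume "A \<subseteq> S"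
  then have "sum p A \<le> f A" "sum q A \<le> f A" using assms unfolding independent_def by auto
  then have "a * sum p A + b * sum q A \<le> a * f A + b * f A"
    using assms by (intro add_mono mult_left_mono) auto
  also have "\<dots> = f A" using assms(5) by (metis distrib_right mult_1)
  finally show "(\<Sum>i\<in>A. a * p i + b * q i) \<le> f A" by (simp add: sum.distrib sum_distrib_left)
qed

text \<open>Monotonicity gives \<open>f {i} \<le> f A\<close> for \<open>i\<close> in
  \<open>A\<close>, and averaging over at most \<open>card S\<close> elements does the rest. This
  supplies an explicit starting point in each polymatroid.\<close>

lemma independent_singletons:
  assumes "finite S" "mono_on (Pow S) f" "f {} = 0"
  shows "independent S f (\<lambda>i. f {i} / card S)"
  unfolding independent_def
proof (intro allI impI)
  fix A assume A: "A \<subseteq> S"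
  show "(\<Sum>i\<in>A. f {i} / card S) \<le> f A"
  proof (cases "S = {}")
    case True then show ?thesis using A assms by simp
  next
    case False
    have fin: "finite A" using A assms finite_subset by blast
    have c: "real (card S) > 0" using False assms(1) by (simp add: card_gt_0_iff)
    have f0: "0 \<le> f A" using mono_onD[OF assms(2), of "{}" A] A assms(3) by simp
    have "(\<Sum>i\<in>A. f {i} / card S) \<le> (\<Sum>i\<in>A. f A / card S)"
      using A by (intro sum_mono divide_right_mono mono_onD[OF assms(2)]) auto
    also have "\<dots> = f A * (card A / card S)" by simp
    also have "\<dots> \<le> f A * 1"
      using f0 c card_mono[OF assms(1) A] by (intro mult_left_mono) auto
    finally show ?thesis by simp
  qed
qed

text \<open>Truncating a monotone weight at two thresholds localises the optimality gap
  \<open>\<Sum>s i * (x i - y i)\<close> of \<open>y\<close> to a single level set.\<close>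

lemma level_set_gap:
  fixes s x y :: "'a \<Rightarrow> real"
  assumes "finite S" "\<And>i. i \<in> S \<Longrightarrow> 0 \<le> s i" "\<And>i. i \<in> S \<Longrightarrow> 0 \<le> x i" "\<And>i. i \<in> S \<Longrightarrow> 0 \<le> y i"
    and opt: "\<And>\<phi>. mono \<phi> \<Longrightarrow> (\<And>u. 0 \<le> u \<Longrightarrow> 0 \<le> \<phi> u) \<Longrightarrow>
      (\<Sum>i\<in>S. \<phi> (s i) * y i) \<le> (\<Sum>i\<in>S. \<phi> (s i) * x i)"
    and ab: "0 \<le> b" "b < a"
  shows "sum x {i\<in>S. a \<le> s i} \<le> sum y {i\<in>S. b < s i} + (\<Sum>i\<in>S. s i * (x i - y i)) / (a - b)"
proof -
  define \<psi> where "\<psi> = (\<lambda>u. min (max (u - b) 0) (a - b))"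
  \<comment> \<open>The ramp \<open>\<psi>\<close> and its complement \<open>u - \<psi> u\<close>
    are both monotone. Optimality for the complement shows that the gap for \<open>\<psi>\<close>
    alone is at most the whole gap.\<close>
  have "(\<Sum>i\<in>S. (s i - \<psi> (s i)) * y i) \<le> (\<Sum>i\<in>S. (s i - \<psi> (s i)) * x i)"
    using ab by (intro opt[of "\<lambda>u. u - \<psi> u"]) (auto simp: \<psi>_def mono_def min_def max_def)
  then have 1: "(\<Sum>i\<in>S. \<psi> (s i) * x i) \<le> (\<Sum>i\<in>S. \<psi> (s i) * y i) + (\<Sum>i\<in>S. s i * (x i - y i))"
    by (simp add: algebra_simps sum_subtractf)
  have "(a - b) * sum x {i\<in>S. a \<le> s i} = (\<Sum>i\<in>{i\<in>S. a \<le> s i}. \<psi> (s i) * x i)"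
    unfolding sum_distrib_left using ab by (intro sum.cong) (auto simp: \<psi>_def)
  also have "\<dots> \<le> (\<Sum>i\<in>S. \<psi> (s i) * x i)"
    using assms by (intro sum_mono2) (auto simp: \<psi>_def)
  also note 1
  also have "(\<Sum>i\<in>S. \<psi> (s i) * y i) = (\<Sum>i\<in>{i\<in>S. b < s i}. \<psi> (s i) * y i)"
    using assms by (intro sum.mono_neutral_right) (auto simp: \<psi>_def)
  also have "\<dots> \<le> (\<Sum>i\<in>{i\<in>S. b < s i}. (a - b) * y i)"
    using assms by (intro sum_mono mult_right_mono) (auto simp: \<psi>_def)
  also have "\<dots> = (a - b) * sum y {i\<in>S. b < s i}" by (simp add: sum_distrib_left)
  finally have "(a - b) * (sum x {i\<in>S. a \<le> s i} - sum y {i\<in>S. b < s i}) \<le> (\<Sum>i\<in>S. s i * (x i - y i))"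
    by (simp add: algebra_simps)
  then have "sum x {i\<in>S. a \<le> s i} - sum y {i\<in>S. b < s i} \<le> (\<Sum>i\<in>S. s i * (x i - y i)) / (a - b)"
    using ab by (simp add: field_simps)
  then show ?thesis by simp
qed

section \<open>A lower bound on the cost of every search\<close>

lemma search_cost_gain:
  "search_cost S f g \<pi> = (\<Sum>j\<in>S. gain g \<pi> j * f (searched \<pi> j))"
  by (simp add: search_cost_def gain_def)

text \<open>Of two distinct elements exactly one comes first in \<open>\<sigma>\<close>, so the pair
  contributes \<open>p i * w j\<close> or \<open>p j * w i\<close>, at least the minimum. Doubling
  the cost counts each diagonal term twice, and the second copy is the separate sum of the
  \<open>p i * w i\<close>.\<close>

lemma search_cost_lower:
  assumes "distinct \<sigma>" "set \<sigma> = S" "mono_on (Pow S) g"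
    and p: "independent S f p" "\<And>i. i \<in> S \<Longrightarrow> 0 \<le> p i"
    and w: "independent S (dual S g) w"
  shows "(\<Sum>i\<in>S. p i * w i) + (\<Sum>i\<in>S. \<Sum>j\<in>S. min (p i * w j) (p j * w i)) \<le> 2 * search_cost S f g \<sigma>"
proof -
  have fin: "finite S" using assms(2) by auto
  have sub: "searched \<sigma> j \<subseteq> S" if "j \<in> S" for j using searched_subset assms(2) that by metis
  have sub': "searched (rev \<sigma>) j \<subseteq> S" if "j \<in> S" for j
    using searched_subset[of j "rev \<sigma>"] assms(2) that by simp
  have g0: "0 \<le> gain g \<sigma> j" if "j \<in> S" for j
    using gain_nonneg[OF assms(3), of \<sigma> j] assms(2) that by simp
  \<comment> \<open>The indicator that \<open>i\<close> is found no later than \<open>j\<close>. It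
    describes prefixes of \<open>\<sigma>\<close> in its first argument and, by reversal, prefixes
    of \<open>rev \<sigma>\<close> in its second.\<close>
  define I where "I = (\<lambda>i j. of_bool (i \<in> searched \<sigma> j) :: real)"
  have sI: "sum h (searched \<sigma> j) = (\<Sum>i\<in>S. I i j * h i)" if "j \<in> S" for h :: "'a \<Rightarrow> real" and j
    unfolding I_def using sub[OF that] fin by (simp add: Int_absorb1 Int_commute)
  have sI': "sum h (searched (rev \<sigma>) i) = (\<Sum>j\<in>S. I i j * h j)" if "i \<in> S" for h :: "'a \<Rightarrow> real" and i
  proof -
    have "(\<Sum>j\<in>S. I i j * h j) = (\<Sum>j\<in>S. if j \<in> searched (rev \<sigma>) i then h j else 0)"
      unfolding I_def using searched_rev[OF assms(1), of i] assms(2) that by (intro sum.cong) auto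
    also have "\<dots> = sum h (searched (rev \<sigma>) i)" using sub'[OF that] fin
      by (simp add: sum.If_cases Int_absorb1)
    finally show ?thesis by simp
  qed
  \<comment> \<open>The vectors are replaced one at a time: \<open>w\<close> is bounded by the dual
    on prefixes of \<open>rev \<sigma>\<close>, which is rewritten through the gains of
    \<open>g\<close>; after exchanging the sums, \<open>p\<close> is bounded by \<open>f\<close> on
    prefixes of \<open>\<sigma>\<close>.\<close>
  have "(\<Sum>i\<in>S. \<Sum>j\<in>S. I i j * (p i * w j)) = (\<Sum>i\<in>S. p i * sum w (searched (rev \<sigma>) i))"
    by (simp add: sI' sum_distrib_left algebra_simps)
  also have "\<dots> \<le> (\<Sum>i\<in>S. p i * dual S g (searched (rev \<sigma>) i))"
    using p(2) w sub' unfolding independent_def by (intro sum_mono mult_left_mono) auto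
  also have "\<dots> = (\<Sum>i\<in>S. p i * sum (gain (dual S g) (rev \<sigma>)) (searched (rev \<sigma>) i))"
    using assms(1,2) by (intro sum.cong refl arg_cong2[of _ _ _ _ "(*)"] sum_gain_searched[symmetric])
      (auto simp: dual_def)
  also have "\<dots> = (\<Sum>i\<in>S. p i * (\<Sum>j\<in>S. I i j * gain (dual S g) (rev \<sigma>) j))"
    by (simp add: sI')
  also have "\<dots> = (\<Sum>i\<in>S. p i * (\<Sum>j\<in>S. I i j * gain g \<sigma> j))"
    using gain_dual[OF assms(1)] assms(2) by simp
  also have "\<dots> = (\<Sum>j\<in>S. gain g \<sigma> j * sum p (searched \<sigma> j))"
    unfolding sum_distrib_left by (subst sum.swap) (simp add: sI sum_distrib_left algebra_simps)
  also have "\<dots> \<le> search_cost S f g \<sigma>"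
    unfolding search_cost_gain using g0 p(1) sub unfolding independent_def
    by (intro sum_mono mult_left_mono) auto
  finally have 1: "(\<Sum>i\<in>S. \<Sum>j\<in>S. I i j * (p i * w j)) \<le> search_cost S f g \<sigma>" .
  have total: "i \<in> searched \<sigma> j \<longleftrightarrow> j \<notin> searched \<sigma> i" if "i \<in> S" "j \<in> S" "i \<noteq> j" for i j
    using searched_rev[OF assms(1), of i j] searched_rev_compl[OF assms(1), of i] assms(2) that
    by auto
  have "(\<Sum>i\<in>S. p i * w i) = (\<Sum>i\<in>S. \<Sum>j\<in>S. of_bool (i = j) * min (p i * w j) (p j * w i))"
    using fin by (simp add: of_bool_def if_distrib[of "\<lambda>x. x * _"] cong: if_cong)
  then have "(\<Sum>i\<in>S. p i * w i) + (\<Sum>i\<in>S. \<Sum>j\<in>S. min (p i * w j) (p j * w i))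
    = (\<Sum>i\<in>S. \<Sum>j\<in>S. (1 + of_bool (i = j)) * min (p i * w j) (p j * w i))"
    by (simp add: sum.distrib[symmetric] distrib_right add.commute)
  also have "\<dots> \<le> (\<Sum>i\<in>S. \<Sum>j\<in>S. I i j * (p i * w j) + I j i * (p j * w i))"
  proof (intro sum_mono)
    fix i j assume "i \<in> S" "j \<in> S"
    show "(1 + of_bool (i = j)) * min (p i * w j) (p j * w i) \<le> I i j * (p i * w j) + I j i * (p j * w i)"
    proof (cases "i = j")
      case False
      then show ?thesis using total[OF \<open>i\<in>S\<close> \<open>j\<in>S\<close>] by (auto simp: I_def)
    next
      case True then show ?thesis by (simp add: I_def searched_def)
    qed
  qed
  also have "\<dots> = 2 * (\<Sum>i\<in>S. \<Sum>j\<in>S. I i j * (p i * w j))"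
    by (subst sum.distrib[THEN sum.cong[OF refl]], subst sum.distrib)
      (subst (2) sum.swap, simp)
  finally show ?thesis using 1 by simp
qed

section \<open>Approximation or growth of the potential\<close>

text \<open>The gains are exchanged for \<open>p\<close> and \<open>w\<close> by two uses of
  \<open>level_set_gap\<close>. Each use loosens the threshold on the ratios \<open>r\<close> by a
  factor \<open>k\<close> and costs an error proportional to \<open>D\<close> or \<open>E\<close>,
  leaving only the pairs with \<open>r j < k^2 * r i\<close>.\<close>

lemma search_cost_upper:
  assumes fin: "finite S" and q: "\<And>j. j \<in> S \<Longrightarrow> 0 \<le> gain f \<pi> j" and v: "\<And>j. j \<in> S \<Longrightarrow> 0 \<le> gain g \<pi> j"
    and \<pi>: "distinct \<pi>" "set \<pi> = S" "f {} = 0"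
    and p: "\<And>i. i \<in> S \<Longrightarrow> 0 < p i" and r: "\<And>i. i \<in> S \<Longrightarrow> 0 < r i"
    and w: "\<And>i. i \<in> S \<Longrightarrow> w i = (r i)\<^sup>2 * p i"
    and sorted: "sorted_wrt (\<lambda>i j. r i \<ge> r j) \<pi>"
    and optq: "\<And>\<phi>. mono \<phi> \<Longrightarrow> (\<And>u. 0 \<le> u \<Longrightarrow> 0 \<le> \<phi> u) \<Longrightarrow>
      (\<Sum>i\<in>S. \<phi> (r i) * p i) \<le> (\<Sum>i\<in>S. \<phi> (r i) * gain f \<pi> i)"
    and optv: "\<And>\<phi>. mono \<phi> \<Longrightarrow> (\<And>u. 0 \<le> u \<Longrightarrow> 0 \<le> \<phi> u) \<Longrightarrow>
      (\<Sum>i\<in>S. \<phi> (1 / r i) * w i) \<le> (\<Sum>i\<in>S. \<phi> (1 / r i) * gain g \<pi> i)"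
    and D: "D = (\<Sum>i\<in>S. r i * (gain f \<pi> i - p i))"
    and E: "E = (\<Sum>i\<in>S. 1 / r i * (gain g \<pi> i - w i))"
    and H: "H = (\<Sum>i\<in>S. r i * p i)"
    and k: "1 < (k::real)"
  shows "search_cost S f g \<pi> \<le> (\<Sum>i\<in>S. \<Sum>j\<in>S. if r j < k\<^sup>2 * r i then p i * w j else 0)
    + k\<^sup>2 / (k - 1) * (D * (H + E) + E * H)"
proof -
  let ?q = "gain f \<pi>" and ?v = "gain g \<pi>"
  have k0: "k > 0" "k\<^sup>2 > 0" using k by auto
  have w0: "0 < w i" if "i \<in> S" for i using p[OF that] r[OF that] w[OF that] by simp
  have D0: "0 \<le> D" using optq[of "\<lambda>u. u"] unfolding D
    by (simp add: mono_def right_diff_distrib sum_subtractf)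
  have E0: "0 \<le> E" using optv[of "\<lambda>u. u"] unfolding E
    by (simp add: mono_def right_diff_distrib diff_divide_distrib sum_subtractf)
  have H': "H = (\<Sum>i\<in>S. w i / r i)"
    unfolding H using w r by (intro sum.cong) (auto simp: power2_eq_square)
  \<comment> \<open>The error in the bound on \<open>f (searched \<pi> j)\<close> is inversely
    proportional to \<open>r j\<close>, so its total against the gains of \<open>g\<close> is
    governed by this sum.\<close>
  have Y: "(\<Sum>i\<in>S. ?v i / r i) = E + H"
    unfolding E H' by (simp add: diff_divide_distrib sum_subtractf)
  \<comment> \<open>As \<open>r\<close> decreases along \<open>\<pi>\<close>, the prefix up to
    \<open>j\<close> lies in the level set of \<open>r\<close> at \<open>r j\<close>; the two
    thresholds are \<open>r j\<close> and \<open>r j / k\<close>.\<close>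
  have qb: "f (searched \<pi> j) \<le> sum p {i\<in>S. r j / k < r i} + D * k / ((k - 1) * r j)" if j: "j \<in> S" for j
  proof -
    have "searched \<pi> j \<subseteq> {i\<in>S. r j \<le> r i}"
    proof -
      obtain ys zs where s: "\<pi> = ys @ j # zs" using j \<pi> split_list by metis
      have "searched \<pi> j = insert j (set ys)" using \<pi> unfolding s by (intro searched_split) auto
      then show ?thesis using sorted j \<pi>(2) unfolding s by (auto simp: sorted_wrt_append)
    qed
    then have "sum ?q (searched \<pi> j) \<le> sum ?q {i\<in>S. r j \<le> r i}"
      using fin q by (intro sum_mono2) auto
    also have "\<dots> \<le> sum p {i\<in>S. r j / k < r i} + D / (r j - r j / k)"
      unfolding D using fin r[OF j] k
      by (intro level_set_gap optq q less_imp_le[OF p] less_imp_le[OF r]) (auto simp: field_simps)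
    also have "D / (r j - r j / k) = D * k / ((k - 1) * r j)" using k r[OF j] by (simp add: field_simps)
    finally show ?thesis using sum_gain_searched[of \<pi> f j] \<pi> j by simp
  qed
  \<comment> \<open>The same argument for the weight \<open>1 / r\<close>, with thresholds
    \<open>1 / (k * r i)\<close> and \<open>1 / (k^2 * r i)\<close>.\<close>
  have vb: "sum ?v {j\<in>S. r j / k < r i} \<le> sum w {j\<in>S. r j < k\<^sup>2 * r i} + E * k\<^sup>2 / (k - 1) * r i"
    if i: "i \<in> S" for i
  proof -
    have "sum ?v {j\<in>S. r j / k < r i} \<le> sum ?v {j\<in>S. 1 / (k * r i) \<le> 1 / r j}"
      using fin v r[OF i] r k0 by (intro sum_mono2) (auto simp: field_simps)
    also have "\<dots> \<le> sum w {j\<in>S. 1 / (k\<^sup>2 * r i) < 1 / r j} + E / (1 / (k * r i) - 1 / (k\<^sup>2 * r i))"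
      unfolding E using fin r[OF i] k w0 r
      by (intro level_set_gap optv v) (auto simp: field_simps power2_eq_square less_imp_le)
    also have "{j\<in>S. 1 / (k\<^sup>2 * r i) < 1 / r j} = {j\<in>S. r j < k\<^sup>2 * r i}"
      using r r[OF i] k0 by (auto simp: field_simps)
    also have "1 / (k * r i) - 1 / (k\<^sup>2 * r i) = (k - 1) / (k\<^sup>2 * r i)"
      using r[OF i] k0 by (simp add: field_simps power2_eq_square)
    finally show ?thesis by simp
  qed
  have "search_cost S f g \<pi> \<le> (\<Sum>j\<in>S. ?v j * (sum p {i\<in>S. r j / k < r i} + D * k / ((k - 1) * r j)))"
    unfolding search_cost_gain using qb v by (intro sum_mono mult_left_mono) auto
  also have "\<dots> = (\<Sum>j\<in>S. ?v j * sum p {i\<in>S. r j / k < r i}) + D * k / (k - 1) * (\<Sum>j\<in>S. ?v j / r j)"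
    by (simp add: distrib_left sum.distrib sum_distrib_left mult.commute mult.left_commute)
  also have "(\<Sum>j\<in>S. ?v j * sum p {i\<in>S. r j / k < r i})
      = (\<Sum>j\<in>S. \<Sum>i\<in>S. if r j / k < r i then ?v j * p i else 0)"
    using fin by (intro sum.cong refl) (simp add: sum_distrib_left sum.inter_filter if_distrib cong: if_cong)
  also have "\<dots> = (\<Sum>i\<in>S. p i * sum ?v {j\<in>S. r j / k < r i})"
    using fin by (subst sum.swap, intro sum.cong refl)
      (simp add: sum_distrib_left sum.inter_filter if_distrib mult.commute cong: if_cong)
  also have "\<dots> \<le> (\<Sum>i\<in>S. p i * (sum w {j\<in>S. r j < k\<^sup>2 * r i} + E * k\<^sup>2 / (k - 1) * r i))"
    using vb p by (intro sum_mono mult_left_mono) (auto simp: less_imp_le)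
  also have "\<dots> = (\<Sum>i\<in>S. \<Sum>j\<in>S. if r j < k\<^sup>2 * r i then p i * w j else 0) + E * k\<^sup>2 / (k - 1) * H"
  proof -
    have "p i * sum w {j\<in>S. r j < k\<^sup>2 * r i} = (\<Sum>j\<in>S. if r j < k\<^sup>2 * r i then p i * w j else 0)" for i
      using fin by (simp add: sum_distrib_left sum.inter_filter if_distrib cong: if_cong)
    then show ?thesis unfolding H by (simp add: distrib_left sum.distrib sum_distrib_left sum_divide_distrib mult_ac)
  qed
  finally have "search_cost S f g \<pi> \<le> (\<Sum>i\<in>S. \<Sum>j\<in>S. if r j < k\<^sup>2 * r i then p i * w j else 0)
     + E * k\<^sup>2 / (k - 1) * H + D * k / (k - 1) * (E + H)" unfolding Y by simp
  also have "D * k / (k - 1) * (E + H) \<le> D * k\<^sup>2 / (k - 1) * (E + H)"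
  proof -
    have "0 \<le> H" unfolding H using p r by (intro sum_nonneg) (auto simp: less_imp_le)
    moreover have "k \<le> k\<^sup>2" using k by (simp add: power2_eq_square)
    ultimately show ?thesis using D0 E0 k by (intro mult_right_mono divide_right_mono mult_left_mono) auto
  qed
  moreover have "k\<^sup>2 / (k - 1) * (D * (H + E) + E * H)
      = E * k\<^sup>2 / (k - 1) * H + D * k\<^sup>2 / (k - 1) * (E + H)"
    by (simp add: algebra_simps add_divide_distrib)
  ultimately show ?thesis by linarith
qed

text \<open>For \<open>r i \<le> r j\<close> the minimum is \<open>p i * p j * (r i)^2\<close>,
  which already pays for the ordered pair with \<open>j\<close> first. The opposite pair counts only
  for a near tie, where its excess over 0 is at most that minimum plus a multiple of
  \<open>r i * r j\<close>, split so that one copy of the minimum is charged to each order; summing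
  over all ordered pairs yields the square.\<close>

lemma near_tie_sum:
  assumes p: "\<And>i. i \<in> S \<Longrightarrow> 0 < p i" and r: "\<And>i. i \<in> S \<Longrightarrow> 0 < r i"
    and w: "\<And>i. i \<in> S \<Longrightarrow> w i = (r i)\<^sup>2 * p i" and k: "1 \<le> (k::real)"
  shows "(\<Sum>i\<in>S. \<Sum>j\<in>S. if r j < k * r i then p i * w j else 0)
    \<le> (\<Sum>i\<in>S. \<Sum>j\<in>S. min (p i * w j) (p j * w i)) + (k\<^sup>2 - 1) / 2 * (\<Sum>i\<in>S. r i * p i)\<^sup>2"
proof -
  let ?a = "\<lambda>i j. if r j < k * r i then p i * w j else 0"
  let ?m = "\<lambda>i j. min (p i * w j) (p j * w i)"
  have pair: "?a i j + ?a j i \<le> 2 * ?m i j + (k\<^sup>2 - 1) * ((r i * p i) * (r j * p j))"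
    if "i \<in> S" "j \<in> S" "r i \<le> r j" for i j
  proof -
    have pp: "0 < p i * p j" using p that by simp
    have rr: "0 < r i" "0 < r j" using r that by auto
    have m: "?m i j = p i * p j * (r i)\<^sup>2"
    proof -
      have "p i * p j * (r i)\<^sup>2 \<le> p i * p j * (r j)\<^sup>2"
        using pp rr that by (intro mult_left_mono power_mono) auto
      moreover have "p i * w j = p i * p j * (r j)\<^sup>2" "p j * w i = p i * p j * (r i)\<^sup>2"
        using w[OF that(1)] w[OF that(2)] by (simp_all only: mult_ac)
      ultimately show ?thesis by (metis min.absorb2)
    qed
    have e: "(k\<^sup>2 - 1) * ((r i * p i) * (r j * p j)) = p i * p j * ((k\<^sup>2 - 1) * (r i * r j))"
      by (simp add: algebra_simps)
    have a2: "?a j i \<le> p i * p j * (r i)\<^sup>2"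
      using w that pp by (auto simp: mult.commute mult.left_commute)
    have a1: "?a i j \<le> p i * p j * ((r i)\<^sup>2 + (k\<^sup>2 - 1) * (r i * r j))"
    proof (cases "r j < k * r i")
      case True
      \<comment> \<open>The difference of the squares of \<open>r j\<close> and \<open>r i\<close>
        is factored: a near tie bounds the first factor by \<open>(k - 1) * r i\<close>, and
        \<open>r i \<le> k * r j\<close> bounds the second by \<open>(k + 1) * r j\<close>.\<close>
      have x: "(r j - r i) * (r j + r i) \<le> (k * r i - r i) * (r j + k * r j)"
      proof -
        have "r i \<le> k * r j" using mult_mono[OF k that(3)] k rr by simp
        then show ?thesis using True k rr that by (intro mult_mono add_mono) auto
      qed
      have "(r j)\<^sup>2 \<le> (r i)\<^sup>2 + (k\<^sup>2 - 1) * (r i * r j)"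
        using x by (simp add: algebra_simps power2_eq_square)
      then have "p i * p j * (r j)\<^sup>2 \<le> p i * p j * ((r i)\<^sup>2 + (k\<^sup>2 - 1) * (r i * r j))"
        using pp by (intro mult_left_mono) auto
      then show ?thesis using True w that by (simp add: mult.commute mult.left_commute)
    next
      case False
      have "0 \<le> (r i)\<^sup>2 + (k\<^sup>2 - 1) * (r i * r j)" using k rr by (intro add_nonneg_nonneg mult_nonneg_nonneg) auto
      then show ?thesis using False pp by auto
    qed
    show ?thesis unfolding m e using a1 a2 by (simp add: algebra_simps)
  qed
  have pair': "?a i j + ?a j i \<le> 2 * ?m i j + (k\<^sup>2 - 1) * ((r i * p i) * (r j * p j))"
    if "i \<in> S" "j \<in> S" for i j
    using pair[OF that] pair[OF that(2,1)] by (cases "r i \<le> r j") (auto simp: min.commute mult.commute)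
  have "2 * (\<Sum>i\<in>S. \<Sum>j\<in>S. ?a i j) = (\<Sum>i\<in>S. \<Sum>j\<in>S. ?a i j) + (\<Sum>i\<in>S. \<Sum>j\<in>S. ?a j i)"
    by (subst (2) sum.swap) simp
  also have "\<dots> = (\<Sum>i\<in>S. \<Sum>j\<in>S. ?a i j + ?a j i)" by (simp add: sum.distrib)
  also have "\<dots> \<le> (\<Sum>i\<in>S. \<Sum>j\<in>S. 2 * ?m i j + (k\<^sup>2 - 1) * ((r i * p i) * (r j * p j)))"
    by (intro sum_mono pair')
  also have "\<dots> = 2 * (\<Sum>i\<in>S. \<Sum>j\<in>S. ?m i j) + (k\<^sup>2 - 1) * (\<Sum>i\<in>S. r i * p i)\<^sup>2"
    by (simp only: sum.distrib sum_distrib_left[symmetric] power2_eq_square sum_product)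
  finally show ?thesis by simp
qed

text \<open>Both errors in the upper bound are made small multiples of \<open>H^2 / n\<close>, and
  Cauchy-Schwarz bounds \<open>H^2 / n\<close> by the diagonal sum of the
  \<open>p i * w i\<close>.\<close>

lemma two_approx_of_small_gap:
  assumes fin: "finite S" "S \<noteq> {}" and n: "n = real (card S)"
    and p: "\<And>i. i \<in> S \<Longrightarrow> 0 < p i" and r: "\<And>i. i \<in> S \<Longrightarrow> 0 < r i"
    and w: "\<And>i. i \<in> S \<Longrightarrow> w i = (r i)\<^sup>2 * p i"
    and H: "H = (\<Sum>i\<in>S. r i * p i)"
    and cost: "\<And>k. 1 < k \<Longrightarrow> c \<le> (\<Sum>i\<in>S. \<Sum>j\<in>S. if r j < k\<^sup>2 * r i then p i * w j else 0)
    + k\<^sup>2 / (k - 1) * (D * (H + E) + E * H)"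
    and gap: "0 \<le> D" "0 \<le> E" "D + E \<le> 1 / (32 * n\<^sup>2) * H"
  shows "c \<le> (\<Sum>i\<in>S. p i * w i) + (\<Sum>i\<in>S. \<Sum>j\<in>S. min (p i * w j) (p j * w i))"
proof -
  have n1: "1 \<le> n" unfolding n using fin by (simp add: Suc_leI card_gt_0_iff)
  have H0: "0 \<le> H" unfolding H using p r by (intro sum_nonneg) (auto simp: less_imp_le)
  \<comment> \<open>The near-tie error grows linearly in \<open>k - 1\<close>, the gap error like
    its inverse. With \<open>k - 1 = 1 / (8 * n)\<close> they are at most \<open>3 / 8\<close> and
    \<open>1353 / 4096\<close> times \<open>H^2 / n\<close>, together less than one.\<close>
  define x where "x = 1 / (8 * n)"
  define k where "k = 1 + x"
  have x: "0 < x" "x \<le> 1 / 8" unfolding x_def using n1 by (auto simp: field_simps)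
  have k1: "1 < k" unfolding k_def using x by simp
  have k2: "k\<^sup>2 \<le> 1 + 9 / 4 * x"
  proof -
    have "x * x \<le> 1 / 8 * x" using x by (intro mult_right_mono) auto
    then show ?thesis using x unfolding k_def by (simp add: power2_eq_square algebra_simps)
  qed
  have k4: "(k\<^sup>2)\<^sup>2 - 1 \<le> 6 * x"
  proof -
    have "(k\<^sup>2)\<^sup>2 \<le> (1 + 9 / 4 * x)\<^sup>2" using k2 by (intro power_mono) auto
    also have "\<dots> = 1 + 9 / 2 * x + 81 / 16 * (x * x)" by (simp add: power2_eq_square algebra_simps)
    also have "x * x \<le> 1 / 8 * x" using x by (intro mult_right_mono) auto
    finally show ?thesis using x by simp
  qed
  have DE: "D * (H + E) + E * H \<le> 33 / 32 * (1 / (32 * n\<^sup>2) * H\<^sup>2)"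
  proof -
    have e: "1 / (32 * n\<^sup>2) \<le> 1 / 32" using n1 by (simp add: field_simps)
    have "E \<le> 1 / (32 * n\<^sup>2) * H" using gap by simp
    also have "\<dots> \<le> 1 / 32 * H" using e H0 by (intro mult_right_mono) auto
    finally have "D * (H + E) \<le> D * (33 / 32 * H)" using gap by (intro mult_left_mono) auto
    moreover have "E * H \<le> E * (33 / 32 * H)" using gap H0 by (intro mult_left_mono) auto
    ultimately have "D * (H + E) + E * H \<le> (D + E) * (33 / 32 * H)" by (simp add: algebra_simps)
    also have "\<dots> \<le> 1 / (32 * n\<^sup>2) * H * (33 / 32 * H)" using gap H0 by (intro mult_right_mono) auto
    finally show ?thesis by (simp add: power2_eq_square)
  qed
  have kk: "k\<^sup>2 / (k - 1) \<le> 41 / 4 * n"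
  proof -
    have "k\<^sup>2 \<le> 41 / 32" using k2 x by simp
    then have "k\<^sup>2 / (k - 1) \<le> (41 / 32) / (k - 1)" using k1 by (intro divide_right_mono) auto
    then show ?thesis unfolding k_def x_def by simp
  qed
  have "c \<le> (\<Sum>i\<in>S. \<Sum>j\<in>S. if r j < k\<^sup>2 * r i then p i * w j else 0)
    + k\<^sup>2 / (k - 1) * (D * (H + E) + E * H)" by (rule cost[OF k1])
  also have "(\<Sum>i\<in>S. \<Sum>j\<in>S. if r j < k\<^sup>2 * r i then p i * w j else 0)
     \<le> (\<Sum>i\<in>S. \<Sum>j\<in>S. min (p i * w j) (p j * w i)) + ((k\<^sup>2)\<^sup>2 - 1) / 2 * H\<^sup>2"
    unfolding H using k1 by (intro near_tie_sum p r w) auto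
  also have "((k\<^sup>2)\<^sup>2 - 1) / 2 * H\<^sup>2 \<le> 3 * x * H\<^sup>2" using k4 by (intro mult_right_mono) auto
  also have "k\<^sup>2 / (k - 1) * (D * (H + E) + E * H) \<le> 41 / 4 * n * (33 / 32 * (1 / (32 * n\<^sup>2) * H\<^sup>2))"
    using kk DE gap H0 n1 by (intro mult_mono) auto
  also have "\<dots> = 1353 / 4096 / n * H\<^sup>2" using n1 by (simp add: field_simps power2_eq_square)
  finally have 1: "c \<le> (\<Sum>i\<in>S. \<Sum>j\<in>S. min (p i * w j) (p j * w i)) + (3 / 8 + 1353 / 4096) / n * H\<^sup>2"
    unfolding x_def using n1 by (simp add: field_simps)
  have "H\<^sup>2 \<le> n * (\<Sum>i\<in>S. (r i * p i)\<^sup>2)"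
    unfolding H n using Cauchy_Schwarz_ineq_sum[of "\<lambda>_. 1" "\<lambda>i. r i * p i" S] by simp
  also have "(\<Sum>i\<in>S. (r i * p i)\<^sup>2) = (\<Sum>i\<in>S. p i * w i)"
    using w by (intro sum.cong) (auto simp: power2_eq_square)
  finally have 2: "H\<^sup>2 / n \<le> (\<Sum>i\<in>S. p i * w i)" using n1 by (simp add: field_simps)
  have "(3 / 8 + 1353 / 4096) / n * H\<^sup>2 \<le> H\<^sup>2 / n"
    using mult_right_mono[of "3 / 8 + 1353 / 4096" 1 "H\<^sup>2 / n"] n1 by simp
  then show ?thesis using 1 2 by linarith
qed

section \<open>Growth of the potential along a convex combination\<close>

text \<open>With mean \<open>m\<close> and \<open>d = (a - b)^2 / 4\<close> one has
  \<open>a * b = m^2 - d\<close>. If \<open>m - 2 * d\<close> is positive, its square is at most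
  \<open>m^2 - d\<close> because \<open>4 * m - 4 * d\<close> is at least 1; otherwise the bound is
  trivial.\<close>

lemma sqrt_mult_lower:
  assumes "1 / 2 \<le> a" "1 / 2 \<le> (b::real)"
  shows "(a + b) / 2 - (a - b)\<^sup>2 / 2 \<le> sqrt (a * b)"
proof (cases "(a + b) / 2 - (a - b)\<^sup>2 / 2 \<le> 0")
  case True
  moreover have "0 \<le> sqrt (a * b)" using assms by simp
  ultimately show ?thesis by linarith
next
  case False
  define m d where "m = (a + b) / 2" and "d = (a - b)\<^sup>2 / 4"
  have ab: "a * b = m\<^sup>2 - d" unfolding m_def d_def by (simp add: power2_eq_square field_simps)
  have m: "1 / 2 \<le> m" "2 * d < m" "0 \<le> d" using assms False unfolding m_def d_def by auto
  have "(m - 2 * d)\<^sup>2 = m\<^sup>2 - d * (4 * m - 4 * d)" by (simp add: power2_eq_square algebra_simps)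
  also have "\<dots> \<le> m\<^sup>2 - d * 1" using m by (intro diff_left_mono mult_left_mono) auto
  finally have "m - 2 * d \<le> sqrt (a * b)" using ab by (intro real_le_rsqrt) simp
  then show ?thesis unfolding m_def d_def by simp
qed

text \<open>Coordinatewise, after rescaling by the current \<open>p i\<close> and
  \<open>w i\<close>, this is the quadratic lower bound for the geometric mean. The step size
  \<open>c \<le> 1 / 2\<close> keeps both rescaled coordinates at least
  \<open>1 / 2\<close>.\<close>

lemma potential_step:
  assumes p: "\<And>i. i \<in> S \<Longrightarrow> 0 < p i" and r: "\<And>i. i \<in> S \<Longrightarrow> 0 < r i"
    and w: "\<And>i. i \<in> S \<Longrightarrow> w i = (r i)\<^sup>2 * p i"
    and q: "\<And>i. i \<in> S \<Longrightarrow> 0 \<le> q i" "\<And>i. i \<in> S \<Longrightarrow> q i \<le> M * p i"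
    and v: "\<And>i. i \<in> S \<Longrightarrow> 0 \<le> v i" "\<And>i. i \<in> S \<Longrightarrow> v i \<le> M * w i"
    and c: "0 \<le> c" "c \<le> 1 / 2"
    and H: "H = (\<Sum>i\<in>S. r i * p i)"
  shows "H + c / 2 * ((1 - c * M) * ((\<Sum>i\<in>S. r i * q i) + (\<Sum>i\<in>S. v i / r i)) - 2 * H)
    \<le> potential S (\<lambda>i. (1 - c) * p i + c * q i) (\<lambda>i. (1 - c) * w i + c * v i)"
proof -
  have "r i * p i + c / 2 * ((1 - c * M) * (r i * q i + v i / r i) - 2 * (r i * p i))
    \<le> sqrt (((1 - c) * p i + c * q i) * ((1 - c) * w i + c * v i))" if i: "i \<in> S" for i
  proof -
    define \<alpha> \<beta> where "\<alpha> = q i / p i" and "\<beta> = v i / w i"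
    have wi: "0 < w i" using p[OF i] r[OF i] w[OF i] by simp
    have ab: "0 \<le> \<alpha>" "\<alpha> \<le> M" "0 \<le> \<beta>" "\<beta> \<le> M"
      unfolding \<alpha>_def \<beta>_def using q[OF i] v[OF i] p[OF i] wi by (auto simp: field_simps)
    define a b where "a = (1 - c) + c * \<alpha>" and "b = (1 - c) + c * \<beta>"
    have "0 \<le> c * \<alpha>" "0 \<le> c * \<beta>" using ab c by auto
    then have a12: "1 / 2 \<le> a" "1 / 2 \<le> b" unfolding a_def b_def using c by auto
    have pa: "(1 - c) * p i + c * q i = p i * a" "(1 - c) * w i + c * v i = w i * b"
      unfolding a_def b_def \<alpha>_def \<beta>_def using p[OF i] wi by (auto simp: algebra_simps)
    have h: "sqrt (p i * w i) = r i * p i"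
      using w[OF i] p[OF i] r[OF i] by (intro real_sqrt_unique) (auto simp: power2_eq_square)
    have s: "sqrt ((p i * a) * (w i * b)) = r i * p i * sqrt (a * b)"
      unfolding h[symmetric] by (simp add: real_sqrt_mult mult.left_commute mult.commute)
    \<comment> \<open>As both numbers lie between 0 and \<open>M\<close>, the second-order loss is
      controlled by the first-order gain. This produces the factor \<open>1 - c * M\<close>.\<close>
    have "(\<alpha> - \<beta>)\<^sup>2 \<le> M * (\<alpha> + \<beta>)"
    proof -
      have "(\<alpha> - \<beta>)\<^sup>2 = \<bar>\<alpha> - \<beta>\<bar> * \<bar>\<alpha> - \<beta>\<bar>" by (simp add: power2_eq_square)
      also have "\<dots> \<le> M * (\<alpha> + \<beta>)" using ab by (intro mult_mono) auto
      finally show ?thesis .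
    qed
    then have "c\<^sup>2 * (\<alpha> - \<beta>)\<^sup>2 \<le> c\<^sup>2 * (M * (\<alpha> + \<beta>))" by (intro mult_left_mono) auto
    moreover have "(a - b)\<^sup>2 = c\<^sup>2 * (\<alpha> - \<beta>)\<^sup>2" unfolding a_def b_def
      by (simp add: power2_eq_square algebra_simps)
    ultimately have "(a + b) / 2 - c\<^sup>2 * (M * (\<alpha> + \<beta>)) / 2 \<le> sqrt (a * b)"
      using sqrt_mult_lower[OF a12] by simp
    moreover have "(a + b) / 2 - c\<^sup>2 * (M * (\<alpha> + \<beta>)) / 2 = 1 + c / 2 * ((1 - c * M) * (\<alpha> + \<beta>) - 2)"
      unfolding a_def b_def by (simp add: field_simps power2_eq_square)
    ultimately have "r i * p i * (1 + c / 2 * ((1 - c * M) * (\<alpha> + \<beta>) - 2)) \<le> r i * p i * sqrt (a * b)"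
      using p[OF i] r[OF i] by (intro mult_left_mono) auto
    moreover have "r i * p i * \<alpha> = r i * q i" "r i * p i * \<beta> = v i / r i"
      unfolding \<alpha>_def \<beta>_def w[OF i] using p[OF i] r[OF i] by (auto simp: power2_eq_square)
    moreover have "r i * p i * (1 + c / 2 * ((1 - c * M) * (\<alpha> + \<beta>) - 2))
       = r i * p i + c / 2 * ((1 - c * M) * (r i * p i * \<alpha> + r i * p i * \<beta>) - 2 * (r i * p i))"
      by (simp add: algebra_simps)
    ultimately show ?thesis unfolding pa s by (simp only:)
  qed
  then have "(\<Sum>i\<in>S. r i * p i + c / 2 * ((1 - c * M) * (r i * q i + v i / r i) - 2 * (r i * p i)))
    \<le> potential S (\<lambda>i. (1 - c) * p i + c * q i) (\<lambda>i. (1 - c) * w i + c * v i)"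
    unfolding potential_def by (rule sum_mono)
  moreover have "(\<Sum>i\<in>S. r i * p i + c / 2 * ((1 - c * M) * (r i * q i + v i / r i) - 2 * (r i * p i)))
    = H + c / 2 * ((1 - c * M) * ((\<Sum>i\<in>S. r i * q i) + (\<Sum>i\<in>S. v i / r i)) - 2 * H)"
    unfolding H sum.distrib sum_subtractf sum_distrib_left[symmetric] ..
  ultimately show ?thesis by simp
qed

text \<open>The numerical choices: with a relative gap \<open>e\<close>, mixing weight \<open>e / 8\<close> and step \<open>c\<close>
  with \<open>c * M = e / 8\<close>, the potential grows by the factor \<open>1 + c * e / 8\<close>.\<close>

lemma growth_factor:
  fixes e :: real
  assumes "0 \<le> e" "e \<le> 1" "0 \<le> H" "0 \<le> c" "c * M = e / 8" "(1 - e / 8) * ((2 + e) * H) \<le> Z"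
  shows "(1 + c * e / 8) * H \<le> H + c / 2 * ((1 - c * M) * Z - 2 * H)"
proof -
  have "(1 - e / 8) * ((1 - e / 8) * ((2 + e) * H)) \<le> (1 - e / 8) * Z"
    using assms by (intro mult_left_mono) auto
  moreover have "(2 + e / 4) * H \<le> (1 - e / 8) * ((1 - e / 8) * (2 + e)) * H"
  proof (intro mult_right_mono)
    have "e * e \<le> e * 1" "0 \<le> e * e * e" using assms(1,2) by (auto intro: mult_left_le)
    moreover have "(1 - e / 8) * ((1 - e / 8) * (2 + e)) = 2 + e / 2 - 7 / 32 * (e * e) + 1 / 64 * (e * e * e)"
      by (simp add: field_simps)
    ultimately show "2 + e / 4 \<le> (1 - e / 8) * ((1 - e / 8) * (2 + e))" using assms(1) by linarith
  qed fact
  ultimately have "(2 + e / 4) * H \<le> (1 - c * M) * Z" unfolding assms(5) by (simp only: mult.assoc)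
  then have "e / 4 * H \<le> (1 - c * M) * Z - 2 * H" by (simp add: algebra_simps)
  then have "c / 2 * (e / 4 * H) \<le> c / 2 * ((1 - c * M) * Z - 2 * H)" using assms by (intro mult_left_mono) auto
  then show ?thesis by (simp add: algebra_simps)
qed

section \<open>The conditional-gradient iteration on the two polymatroids\<close>

locale search_instance =
  fixes S :: "'a set" and f g :: "'a set \<Rightarrow> real"
  assumes finite_S: "finite S" and nonempty: "S \<noteq> {}"
    and f_mono: "mono_on (Pow S) f" and f_submodular: "submodular_on S f" and f_empty: "f {} = 0"
    and f_pos: "\<And>i. i \<in> S \<Longrightarrow> 0 < f {i}"
    and g_mono: "mono_on (Pow S) g" and g_supermodular: "supermodular_on S g" and g_empty: "g {} = 0"
    and g_less: "\<And>i. i \<in> S \<Longrightarrow> g (S - {i}) < g S"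
begin

abbreviation n :: real where "n \<equiv> real (card S)"

text \<open>The share of the starting vector in each direction: one eighth of the relative gap
  \<open>1 / (32 * n^2)\<close> at which the two cases of the analysis separate.\<close>

definition mix :: real where "mix = 1 / (256 * n ^ 2)"

text \<open>The fixed step length, chosen so that \<open>rate * (256 * n^3) = mix\<close>, where
  \<open>256 * n^3 = n / mix\<close> bounds the ratio of a direction to the current point.\<close>

definition rate :: real where "rate = 1 / (65536 * n ^ 5)"

definition p0 :: "'a \<Rightarrow> real" where "p0 i = f {i} / n"

text \<open>The value of the dual of \<open>g\<close> at \<open>{i}\<close>, divided by
  \<open>n\<close>, in analogy with \<open>p0\<close>.\<close>

definition w0 :: "'a \<Rightarrow> real" where "w0 i = (g S - g (S - {i})) / n"

text \<open>The lower bounds keep the iterates away from zero, where the gradient of the potential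
  is unbounded.\<close>

definition feasible :: "('a \<Rightarrow> real) \<Rightarrow> ('a \<Rightarrow> real) \<Rightarrow> bool" where
  "feasible p w \<longleftrightarrow> independent S f p \<and> independent S (dual S g) w \<and>
     (\<forall>i\<in>S. mix * p0 i \<le> p i \<and> mix * w0 i \<le> w i)"

text \<open>A convex combination of three points of one polymatroid: the current point, the greedy
  vertex and the starting point.\<close>

definition step :: "('a set \<Rightarrow> real) \<Rightarrow> ('a \<Rightarrow> real) \<Rightarrow> 'a list \<Rightarrow> ('a \<Rightarrow> real) \<Rightarrow> 'a \<Rightarrow> real" where
  "step h x0 \<pi> x i = (1 - rate) * x i + rate * ((1 - mix) * gain h \<pi> i + mix * x0 i)"

lemma n_ge_1: "1 \<le> n"
  using finite_S nonempty by (simp add: Suc_leI card_gt_0_iff)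

lemma mix_bounds: "0 < mix" "mix \<le> 1"
proof -
  have "1 \<le> 256 * n ^ 2" using one_le_power[OF n_ge_1, of 2] by linarith
  then show "0 < mix" "mix \<le> 1" unfolding mix_def using frac_le[of 1 1 1 "256 * n ^ 2"] n_ge_1 by auto
qed

lemma rate_bounds: "0 < rate" "rate \<le> 1 / 2"
proof -
  have "2 \<le> 65536 * n ^ 5" using one_le_power[OF n_ge_1, of 5] by linarith
  then show "0 < rate" "rate \<le> 1 / 2" unfolding rate_def using frac_le[of 1 1 2 "65536 * n ^ 5"] n_ge_1 by auto
qed

lemma dual_facts: "submodular_on S (dual S g)" "mono_on (Pow S) (dual S g)" "dual S g {} = 0"
  using submodular_dual[OF g_supermodular] mono_dual[OF g_mono] by (auto simp: dual_def)

lemma p0_pos: "i \<in> S \<Longrightarrow> 0 < p0 i" and w0_pos: "i \<in> S \<Longrightarrow> 0 < w0 i"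
  using f_pos g_less n_ge_1 unfolding p0_def w0_def by auto

lemma independent_p0: "independent S f p0" and independent_w0: "independent S (dual S g) w0"
  using independent_singletons[OF finite_S f_mono f_empty]
    independent_singletons[OF finite_S dual_facts(2,3)]
  unfolding p0_def[abs_def] w0_def[abs_def] dual_def by auto

lemma feasible_start: "feasible p0 w0"
  unfolding feasible_def using independent_p0 independent_w0 mix_bounds p0_pos w0_pos
  by (auto simp: mult_le_cancel_right1 not_less less_imp_le)

lemma feasible_pos:
  assumes "feasible p w" "i \<in> S" shows "0 < p i" "0 < w i"
  using assms mix_bounds p0_pos[OF assms(2)] w0_pos[OF assms(2)] unfolding feasible_def
  by (meson less_le_trans mult_pos_pos)+

lemma independent_gain_dual:
  assumes "distinct \<pi>" "set \<pi> = S"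
  shows "independent S (dual S g) (gain g \<pi>)"
proof -
  have "independent S (dual S g) (gain (dual S g) (rev \<pi>))"
    using gain_independent[OF dual_facts(1,3), of "rev \<pi>"] assms by simp
  moreover have "sum (gain (dual S g) (rev \<pi>)) A = sum (gain g \<pi>) A" if "A \<subseteq> S" for A
    using gain_dual[OF assms(1)] assms(2) that by (intro sum.cong) auto
  ultimately show ?thesis unfolding independent_def by simp
qed

lemma gains_nonneg:
  assumes "distinct \<pi>" "set \<pi> = S" "i \<in> S"
  shows "0 \<le> gain f \<pi> i" "0 \<le> gain g \<pi> i"
  using gain_nonneg[OF f_mono] gain_nonneg[OF g_mono] assms by auto

lemma independent_gain:
  assumes "distinct \<pi>" "set \<pi> = S" shows "independent S f (gain f \<pi>)"
  using gain_independent[OF f_submodular f_empty] assms by auto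

lemma step_independent:
  assumes "independent S h x" "independent S h x0" "independent S h (gain k \<pi>)"
  shows "independent S h (step k x0 \<pi> x)"
  unfolding step_def[abs_def] using assms mix_bounds rate_bounds
  by (intro independent_combination) auto

text \<open>The direction stays above \<open>mix * x0 i\<close> through its admixture of
  \<open>x0\<close>, so a convex combination with \<open>x\<close> does too.\<close>

lemma step_lower:
  assumes "0 \<le> gain k \<pi> i" "mix * x0 i \<le> x i"
  shows "mix * x0 i \<le> step k x0 \<pi> x i"
proof -
  have "mix * x0 i = (1 - rate) * (mix * x0 i) + rate * (mix * x0 i)" by (simp add: algebra_simps)
  also have "\<dots> \<le> (1 - rate) * x i + rate * ((1 - mix) * gain k \<pi> i + mix * x0 i)"
    using assms mix_bounds rate_bounds by (intro add_mono mult_left_mono) auto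
  finally show ?thesis unfolding step_def .
qed

lemma feasible_step:
  assumes "feasible p w" "distinct \<pi>" "set \<pi> = S"
  shows "feasible (step f p0 \<pi> p) (step g w0 \<pi> w)"
  using assms(1) step_independent[OF _ independent_p0 independent_gain[OF assms(2,3)]]
    step_independent[OF _ independent_w0 independent_gain_dual[OF assms(2,3)]]
    step_lower gains_nonneg[OF assms(2,3)]
  unfolding feasible_def by blast

lemma potential_start_pos: "0 < potential S p0 w0"
  unfolding potential_def using finite_S nonempty p0_pos w0_pos by (intro sum_pos) auto

text \<open>A coordinate of an independent vector is at most the value of its singleton, which is
  \<open>n\<close> times the starting coordinate. This caps the total growth.\<close>

lemma potential_le:
  assumes "feasible p w" shows "potential S p w \<le> n * potential S p0 w0"
  unfolding potential_def sum_distrib_left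
proof (intro sum_mono)
  fix i assume i: "i \<in> S"
  have "p i \<le> n * p0 i" "w i \<le> n * w0 i"
    using assms i independent_nonneg_le[of S f p i] independent_nonneg_le[of S "dual S g" w i] n_ge_1
    unfolding feasible_def p0_def w0_def dual_def by auto
  then have "p i * w i \<le> (n * p0 i) * (n * w0 i)"
    using feasible_pos[OF assms i] p0_pos[OF i] n_ge_1 by (intro mult_mono) auto
  then have "sqrt (p i * w i) \<le> sqrt ((n * p0 i) * (n * w0 i))" by simp
  also have "\<dots> = n * sqrt (p0 i * w0 i)"
    using n_ge_1 by (simp add: real_sqrt_mult mult_ac)
  finally show "sqrt (p i * w i) \<le> n * sqrt (p0 i * w0 i)" .
qed

lemma two_approx_or_growth:
  assumes ok: "feasible p w" and \<pi>: "distinct \<pi>" "set \<pi> = S"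
    and sorted: "sorted_wrt (\<lambda>i j. w i / p i \<ge> w j / p j) \<pi>"
  shows "(\<forall>\<sigma>\<in>permutations_of_set S. search_cost S f g \<pi> \<le> 2 * search_cost S f g \<sigma>) \<or>
    (1 + 1 / (2 ^ 24 * n ^ 7)) * potential S p w \<le> potential S (step f p0 \<pi> p) (step g w0 \<pi> w)"
proof -
  \<comment> \<open>Up to the factor \<open>1 / 2\<close>, \<open>r\<close> is the gradient of the
    potential in \<open>p\<close> and \<open>1 / r\<close> the gradient in \<open>w\<close>;
    \<open>D\<close> and \<open>E\<close> are the corresponding first-order gaps.\<close>
  define r where "r i = sqrt (w i / p i)" for i
  define H where "H = (\<Sum>i\<in>S. r i * p i)"
  define D where "D = (\<Sum>i\<in>S. r i * (gain f \<pi> i - p i))"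
  define E where "E = (\<Sum>i\<in>S. 1 / r i * (gain g \<pi> i - w i))"
  note pos = feasible_pos[OF ok]
  have r: "0 < r i" if "i \<in> S" for i using pos[OF that] unfolding r_def by simp
  have w: "w i = (r i)\<^sup>2 * p i" if "i \<in> S" for i using pos[OF that] unfolding r_def by simp
  have H_pot: "H = potential S p w" unfolding H_def potential_def
  proof (intro sum.cong refl)
    fix i assume i: "i \<in> S"
    show "r i * p i = sqrt (p i * w i)"
      using w[OF i] pos[OF i] r[OF i] by (intro real_sqrt_unique[symmetric]) (auto simp: power2_eq_square)
  qed
  have sr: "sorted_wrt (\<lambda>i j. r i \<ge> r j) \<pi>" using sorted unfolding r_def by simp
  \<comment> \<open>A monotone \<open>\<phi>\<close> preserves the order by \<open>r\<close>, so the
    same greedy vertex is optimal for all these weights at once.\<close>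
  have optq: "(\<Sum>i\<in>S. \<phi> (r i) * p i) \<le> (\<Sum>i\<in>S. \<phi> (r i) * gain f \<pi> i)"
    if "mono \<phi>" "\<And>u. 0 \<le> u \<Longrightarrow> 0 \<le> \<phi> u" for \<phi>
    using gain_maximal[of \<pi> f p "\<lambda>i. \<phi> (r i)"] ok \<pi> f_empty that less_imp_le[OF r]
      sorted_wrt_mono_rel[OF _ sr, of "\<lambda>i j. \<phi> (r j) \<le> \<phi> (r i)"]
    unfolding feasible_def by (simp add: monoD)
  \<comment> \<open>The weight \<open>1 / r\<close> decreases along \<open>rev \<pi>\<close>, and
    the greedy vertex of the dual in that order consists of the gains of \<open>g\<close> along
    \<open>\<pi>\<close>.\<close>
  have optv: "(\<Sum>i\<in>S. \<phi> (1 / r i) * w i) \<le> (\<Sum>i\<in>S. \<phi> (1 / r i) * gain g \<pi> i)"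
    if \<phi>: "mono \<phi>" "\<And>u. 0 \<le> u \<Longrightarrow> 0 \<le> \<phi> u" for \<phi>
  proof -
    have "sorted_wrt (\<lambda>i j. \<phi> (1 / r i) \<ge> \<phi> (1 / r j)) (rev \<pi>)"
      unfolding sorted_wrt_rev
      by (rule sorted_wrt_mono_rel[OF _ sr]) (use r \<pi>(2) in \<open>auto intro!: monoD[OF \<phi>(1)] simp: field_simps\<close>)
    then have "(\<Sum>i\<in>S. \<phi> (1 / r i) * w i) \<le> (\<Sum>i\<in>S. \<phi> (1 / r i) * gain (dual S g) (rev \<pi>) i)"
      using gain_maximal[of "rev \<pi>" "dual S g" w "\<lambda>i. \<phi> (1 / r i)"] ok \<pi> dual_facts(3) \<phi> less_imp_le[OF r]
      unfolding feasible_def by simp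
    then show ?thesis using gain_dual[OF \<pi>(1)] \<pi>(2) by simp
  qed
  have D0: "0 \<le> D" using optq[of "\<lambda>u. u"] unfolding D_def
    by (simp add: mono_def right_diff_distrib sum_subtractf)
  have E0: "0 \<le> E" using optv[of "\<lambda>u. u"] unfolding E_def
    by (simp add: mono_def right_diff_distrib diff_divide_distrib sum_subtractf)
  have H0: "0 \<le> H" unfolding H_def using r pos by (intro sum_nonneg) (simp add: less_imp_le)
  define e where "e = 1 / (32 * n\<^sup>2)"
  have "1 \<le> 32 * n\<^sup>2" using one_le_power[OF n_ge_1, of 2] by linarith
  then have e: "0 \<le> e" "e \<le> 1" "mix = e / 8" unfolding e_def mix_def
    using frac_le[of 1 1 1 "32 * n\<^sup>2"] by auto
  show ?thesis
  proof (cases "D + E \<le> e * H")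
    case True
    have "search_cost S f g \<pi> \<le> (\<Sum>i\<in>S. p i * w i) + (\<Sum>i\<in>S. \<Sum>j\<in>S. min (p i * w j) (p j * w i))"
    proof (rule two_approx_of_small_gap[OF finite_S nonempty refl pos(1) r w H_def _ D0 E0])
      fix k :: real assume "1 < k"
      then show "search_cost S f g \<pi> \<le> (\<Sum>i\<in>S. \<Sum>j\<in>S. if r j < k\<^sup>2 * r i then p i * w j else 0)
          + k\<^sup>2 / (k - 1) * (D * (H + E) + E * H)"
        by (intro search_cost_upper[OF finite_S gains_nonneg[OF \<pi>] \<pi> f_empty pos(1) r w sr optq optv
          D_def E_def H_def])
    qed (use True e_def in auto)
    moreover have "(\<Sum>i\<in>S. p i * w i) + (\<Sum>i\<in>S. \<Sum>j\<in>S. min (p i * w j) (p j * w i))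
        \<le> 2 * search_cost S f g \<sigma>" if "\<sigma> \<in> permutations_of_set S" for \<sigma>
      using that ok pos(1) unfolding feasible_def permutations_of_set_def
      by (intro search_cost_lower g_mono) (auto simp: less_imp_le)
    ultimately show ?thesis by (meson order_trans)
  next
    case False
    \<comment> \<open>Since \<open>M * mix = n\<close>, a direction coordinate is at most its
      singleton value, that is \<open>M\<close> times the lower bound \<open>mix * p0 i\<close> or
      \<open>mix * w0 i\<close>, hence at most \<open>M\<close> times the current
      coordinate.\<close>
    define M where "M = 256 * n ^ 3"
    let ?q = "\<lambda>i. (1 - mix) * gain f \<pi> i + mix * p0 i"
    let ?v = "\<lambda>i. (1 - mix) * gain g \<pi> i + mix * w0 i"
    have nmix: "n = M * mix" unfolding M_def mix_def using n_ge_1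
      by (simp add: power2_eq_square power3_eq_cube)
    have q: "0 \<le> ?q i" "?q i \<le> M * p i" if i: "i \<in> S" for i
    proof -
      show "0 \<le> ?q i" using gains_nonneg[OF \<pi> i] mix_bounds p0_pos[OF i] by simp
      have "independent S f ?q"
        using independent_gain[OF \<pi>] independent_p0 mix_bounds by (intro independent_combination) auto
      then have "?q i \<le> f {i}" using independent_nonneg_le i by fast
      also have "\<dots> = M * (mix * p0 i)" using n_ge_1 unfolding p0_def mult.assoc[symmetric] nmix[symmetric] by simp
      also have "\<dots> \<le> M * p i" using ok i unfolding feasible_def M_def by (intro mult_left_mono) auto
      finally show "?q i \<le> M * p i" .
    qed
    have v: "0 \<le> ?v i" "?v i \<le> M * w i" if i: "i \<in> S" for i
    proof -
      show "0 \<le> ?v i" using gains_nonneg[OF \<pi> i] mix_bounds w0_pos[OF i] by simp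
      have "independent S (dual S g) ?v"
        using independent_gain_dual[OF \<pi>] independent_w0 mix_bounds by (intro independent_combination) auto
      then have "?v i \<le> dual S g {i}" using independent_nonneg_le i by fast
      also have "\<dots> = M * (mix * w0 i)" using n_ge_1
        unfolding w0_def dual_def mult.assoc[symmetric] nmix[symmetric] by simp
      also have "\<dots> \<le> M * w i" using ok i unfolding feasible_def M_def by (intro mult_left_mono) auto
      finally show "?v i \<le> M * w i" .
    qed
    define Z where "Z = (\<Sum>i\<in>S. r i * ?q i) + (\<Sum>i\<in>S. ?v i / r i)"
    have gap: "(\<Sum>i\<in>S. r i * gain f \<pi> i) + (\<Sum>i\<in>S. gain g \<pi> i / r i) = D + E + 2 * H"
    proof -
      have "H = (\<Sum>i\<in>S. w i / r i)"
        unfolding H_def using w r by (intro sum.cong) (auto simp: power2_eq_square)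
      then show ?thesis unfolding D_def E_def using H_def
        by (simp add: right_diff_distrib diff_divide_distrib sum_subtractf)
    qed
    \<comment> \<open>The admixture of the starting vectors contributes nonnegatively, so mixing
      loses at most the factor \<open>1 - mix\<close>.\<close>
    have "(1 - mix) * (D + E + 2 * H) \<le> Z"
    proof -
      have "(\<Sum>i\<in>S. r i * ((1 - mix) * gain f \<pi> i)) \<le> (\<Sum>i\<in>S. r i * ?q i)"
        using r mix_bounds p0_pos by (intro sum_mono mult_left_mono) (auto simp: less_imp_le)
      moreover have "(\<Sum>i\<in>S. (1 - mix) * gain g \<pi> i / r i) \<le> (\<Sum>i\<in>S. ?v i / r i)"
        using r mix_bounds w0_pos by (intro sum_mono divide_right_mono) (auto simp: less_imp_le)
      ultimately show ?thesis unfolding Z_def gap[symmetric]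
        by (simp add: sum_distrib_left distrib_left mult_ac)
    qed
    moreover have "(1 - mix) * ((2 + e) * H) \<le> (1 - mix) * (D + E + 2 * H)"
      using False mix_bounds by (intro mult_left_mono) (auto simp: algebra_simps)
    ultimately have Z: "(1 - e / 8) * ((2 + e) * H) \<le> Z" unfolding e(3)[symmetric] by (rule order_trans[rotated])
    have cM: "rate * M = e / 8" unfolding rate_def M_def e_def using n_ge_1
      by (simp add: power_eq_if)
    have "(1 + rate * e / 8) * H \<le> H + rate / 2 * ((1 - rate * M) * Z - 2 * H)"
      by (rule growth_factor[OF e(1,2) H0 _ cM Z]) (use rate_bounds in auto)
    also have "\<dots> \<le> potential S (step f p0 \<pi> p) (step g w0 \<pi> w)"
      unfolding Z_def step_def[abs_def]
      by (intro potential_step pos r w q v H_def) (use rate_bounds in auto)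
    also have "rate * e / 8 = 1 / (2 ^ 24 * n ^ 7)"
      unfolding rate_def e_def using n_ge_1 by (simp add: power_eq_if)
    finally show ?thesis unfolding H_pot by blast
  qed
qed

end

section \<open>Total correctness with time bounds\<close>

fun iwrites :: "com \<Rightarrow> vname set" where
  "iwrites (IAssign x es e) = {x}"
| "iwrites (Seq c c') = iwrites c \<union> iwrites c'"
| "iwrites (Cond b c c') = iwrites c \<union> iwrites c'"
| "iwrites (While b c) = iwrites c"
| "iwrites _ = {}"

fun rwrites :: "com \<Rightarrow> vname set" where
  "rwrites (RAssign x es e) = {x}"
| "rwrites (Query q x es a es') = {x}"
| "rwrites (Seq c c') = rwrites c \<union> rwrites c'"
| "rwrites (Cond b c c') = rwrites c \<union> rwrites c'"
| "rwrites (While b c) = rwrites c"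
| "rwrites _ = {}"

text \<open>A syntactic frame rule, so that the specification of a command need only mention the
  variables it concerns.\<close>

lemma exec_frame:
  "exec n ora c s t s' \<Longrightarrow> (\<forall>x. x \<notin> iwrites c \<longrightarrow> imem s' x = imem s x) \<and>
    (\<forall>x. x \<notin> rwrites c \<longrightarrow> rmem s' x = rmem s x)"
  by (induction rule: exec.induct) (auto simp: iupd_def rupd_def)

text \<open>An upper bound on the running time when every loop makes at most \<open>K\<close> iterations.\<close>

fun time_bound :: "nat \<Rightarrow> com \<Rightarrow> nat" where
  "time_bound K Skip = 1"
| "time_bound K (IAssign x es e) = 1 + sum_list (map icost es) + icost e"
| "time_bound K (RAssign x es e) = 1 + sum_list (map icost es) + rcost e"
| "time_bound K (Query q x es a es') = 1 + sum_list (map icost es) + sum_list (map icost es')"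
| "time_bound K (Seq c c') = time_bound K c + time_bound K c'"
| "time_bound K (Cond b c c') = 1 + bcost b + time_bound K c + time_bound K c'"
| "time_bound K (While b c) = K * (1 + bcost b + time_bound K c) + (1 + bcost b)"

text \<open>Each loop multiplies by the variable \<open>[:0, 1:]\<close>, so for a fixed program the
  degree is at most the nesting depth of its loops.\<close>

lemma time_bound_poly: "\<exists>p. \<forall>K. time_bound K c = poly p K"
proof (induction c)
  case (Seq c c')
  then obtain p q where "\<forall>K. time_bound K c = poly p K" "\<forall>K. time_bound K c' = poly q K" by blast
  then show ?case by (intro exI[of _ "p + q"]) simp
next
  case (Cond b c c')
  then obtain p q where "\<forall>K. time_bound K c = poly p K" "\<forall>K. time_bound K c' = poly q K" by blast
  then show ?case by (intro exI[of _ "[:1 + bcost b:] + p + q"]) simp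
next
  case (While b c)
  then obtain p where "\<forall>K. time_bound K c = poly p K" by blast
  then show ?case by (intro exI[of _ "[:0, 1:] * ([:1 + bcost b:] + p) + [:1 + bcost b:]"]) simp
qed (auto intro: exI[of _ "[:_:]"])

text \<open>Total correctness with a bound that depends only on the syntax and \<open>K\<close>;
  loop invariants therefore never mention elapsed time.\<close>

definition runs ::
    "nat \<Rightarrow> (ora_name \<Rightarrow> nat set \<Rightarrow> real) \<Rightarrow> nat \<Rightarrow> com \<Rightarrow> state \<Rightarrow> (state \<Rightarrow> bool) \<Rightarrow> bool" where
  "runs n ora K c s Q \<longleftrightarrow> (\<exists>t s'. exec n ora c s t s' \<and> t \<le> time_bound K c \<and> Q s')"

definition unchanged :: "com \<Rightarrow> state \<Rightarrow> state \<Rightarrow> bool" where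
  "unchanged c s s' \<longleftrightarrow> (\<forall>x. x \<notin> iwrites c \<longrightarrow> imem s' x = imem s x) \<and>
    (\<forall>x. x \<notin> rwrites c \<longrightarrow> rmem s' x = rmem s x)"

lemma runs_conseq:
  assumes "runs n ora K c s Q" "\<And>s'. Q s' \<Longrightarrow> unchanged c s s' \<Longrightarrow> Q' s'"
  shows "runs n ora K c s Q'"
  using assms exec_frame unfolding runs_def unchanged_def by metis

lemma runs_Skip: "Q s \<Longrightarrow> runs n ora K Skip s Q"
  unfolding runs_def using exec.Skip by fastforce

lemma runs_IAssign: "Q (iupd x (map (ival s) es) (ival s e) s) \<Longrightarrow> runs n ora K (IAssign x es e) s Q"
  unfolding runs_def using exec.IAssign by fastforce

lemma runs_RAssign: "Q (rupd x (map (ival s) es) (rval s e) s) \<Longrightarrow> runs n ora K (RAssign x es e) s Q"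
  unfolding runs_def using exec.RAssign by fastforce

lemma runs_Query:
  "Q (rupd x (map (ival s) es) (ora q {k. k < n \<and> imem s a (map (ival s) es' @ [k]) \<noteq> 0}) s) \<Longrightarrow>
    runs n ora K (Query q x es a es') s Q"
  unfolding runs_def using exec.Query by fastforce

lemma runs_Query_set:
  assumes "{k. k < n \<and> imem s a (map (ival s) es' @ [k]) \<noteq> 0} = A"
    "Q (rupd x (map (ival s) es) (ora q A) s)"
  shows "runs n ora K (Query q x es a es') s Q"
  using runs_Query[of Q x s es ora q n a es' K] assms by simp
lemma runs_Seq:
  assumes "runs n ora K c s (\<lambda>s'. runs n ora K c' s' Q)"
  shows "runs n ora K (Seq c c') s Q"
proof -
  obtain t s' u s'' where "exec n ora c s t s'" "t \<le> time_bound K c"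
    "exec n ora c' s' u s''" "u \<le> time_bound K c'" "Q s''"
    using assms unfolding runs_def by blast
  then show ?thesis unfolding runs_def
    by (intro exI[of _ "t + u"] exI[of _ s'']) (auto intro: exec.Seq)
qed

lemma runs_Cond:
  assumes "bval s b \<Longrightarrow> runs n ora K c s Q" "\<not> bval s b \<Longrightarrow> runs n ora K c' s Q"
  shows "runs n ora K (Cond b c c') s Q"
proof (cases "bval s b")
  case True
  then obtain t s' where "exec n ora c s t s'" "t \<le> time_bound K c" "Q s'"
    using assms(1) unfolding runs_def by blast
  then show ?thesis using exec.CondTrue[OF True, of n ora c t s' c'] unfolding runs_def
    by (intro exI[of _ "1 + bcost b + t"] exI[of _ s']) simp
next
  case False
  then obtain t s' where "exec n ora c' s t s'" "t \<le> time_bound K c'" "Q s'"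
    using assms(2) unfolding runs_def by blast
  then show ?thesis using exec.CondFalse[OF False, of n ora c' t s' c] unfolding runs_def
    by (intro exI[of _ "1 + bcost b + t"] exI[of _ s']) simp
qed

text \<open>The invariant is indexed by the number of completed rounds and fixes it to be exactly
  \<open>m\<close>. The induction is on the number \<open>d\<close> of rounds still to come.\<close>

lemma runs_While:
  assumes "m \<le> K" "I 0 s"
    and body: "\<And>k s'. k < m \<Longrightarrow> I k s' \<Longrightarrow> bval s' b \<and> runs n ora K c s' (I (Suc k))"
    and exit: "\<And>s'. I m s' \<Longrightarrow> \<not> bval s' b"
  shows "runs n ora K (While b c) s (I m)"
proof -
  have "\<exists>t s'. exec n ora (While b c) s t s' \<and>
      t \<le> d * (1 + bcost b + time_bound K c) + (1 + bcost b) \<and> I m s'"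
    if "k + d = m" "I k s" for d k s
    using that
  proof (induction d arbitrary: k s)
    case 0
    then show ?case using exit[of s] exec.WhileFalse[of s b n ora c]
      by (intro exI[of _ "1 + bcost b"] exI[of _ s]) auto
  next
    case (Suc d)
    then have b: "bval s b" and "runs n ora K c s (I (Suc k))" using body[of k s] by auto
    then obtain t s' where 1: "exec n ora c s t s'" "t \<le> time_bound K c" "I (Suc k) s'"
      unfolding runs_def by blast
    then obtain u s'' where 2: "exec n ora (While b c) s' u s''"
      "u \<le> d * (1 + bcost b + time_bound K c) + (1 + bcost b)" "I m s''"
      using Suc.IH[of "Suc k" s'] Suc.prems by auto
    show ?case using exec.WhileTrue[OF b 1(1) 2(1)] 1(2) 2(2,3)
      by (intro exI[of _ "1 + bcost b + t + u"] exI[of _ s'']) simp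
  qed
  from this[of 0 m s] obtain t s' where t: "exec n ora (While b c) s t s'"
      "t \<le> m * (1 + bcost b + time_bound K c) + (1 + bcost b)" "I m s'" using assms(2) by auto
  moreover have "m * (1 + bcost b + time_bound K c) \<le> K * (1 + bcost b + time_bound K c)"
    using assms(1) by (rule mult_le_mono1)
  ultimately have "t \<le> time_bound K (While b c)" by simp
  then show ?thesis unfolding runs_def using t by blast
qed

lemma imem_iupd: "imem (iupd x is k s) y = (if y = x then (imem s x)(is := k) else imem s y)"
  and rmem_iupd: "rmem (iupd x is k s) = rmem s"
  and rmem_rupd: "rmem (rupd x is v s) y = (if y = x then (rmem s x)(is := v) else rmem s y)"
  and imem_rupd: "imem (rupd x is v s) = imem s"
  by (auto simp: iupd_def rupd_def)

lemmas mem_simps = imem_iupd rmem_iupd rmem_rupd imem_rupd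

abbreviation Seq_infix :: "com \<Rightarrow> com \<Rightarrow> com" (infixr ";;" 60) where "c ;; c' \<equiv> Seq c c'"
abbreviation ivar :: "vname \<Rightarrow> iexp" where "ivar x \<equiv> IVar x []"
abbreviation rvar :: "vname \<Rightarrow> rexp" where "rvar x \<equiv> RVar x []"

definition For :: "vname \<Rightarrow> com \<Rightarrow> com" where
  "For x c = Seq (IAssign x [] (IConst 0))
     (While (ILess (ivar x) (ivar ''n'')) (Seq c (IAssign x [] (IAdd (ivar x) (IConst 1)))))"

lemma writes_For [simp]: "iwrites (For x c) = insert x (iwrites c)" "rwrites (For x c) = rwrites c"
  by (auto simp: For_def)

text \<open>The body must establish the invariant for the state in which the counter is already
  advanced. The strengthened invariant \<open>J\<close> also carries the counter, the bound and the
  frame condition, which the body may then use.\<close>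

lemma runs_For:
  assumes n: "n \<le> K" "imem s ''n'' [] = n" and x: "x \<noteq> ''n''" "x \<notin> iwrites c" "''n'' \<notin> iwrites c"
    and init: "I 0 (iupd x [] 0 s)"
    and body: "\<And>k s'. k < n \<Longrightarrow> I k s' \<Longrightarrow> imem s' x [] = k \<Longrightarrow> imem s' ''n'' [] = n \<Longrightarrow>
      unchanged (For x c) s s' \<Longrightarrow> runs n ora K c s' (\<lambda>s''. I (Suc k) (iupd x [] (Suc k) s''))"
  shows "runs n ora K (For x c) s (I n)"
proof -
  define J where "J k s' \<longleftrightarrow> I k s' \<and> imem s' x [] = k \<and> imem s' ''n'' [] = n \<and> unchanged (For x c) s s'"
    for k s'
  have "runs n ora K (While (ILess (ivar x) (ivar ''n'')) (Seq c (IAssign x [] (IAdd (ivar x) (IConst 1)))))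
      (iupd x [] 0 s) (J n)"
  proof (rule runs_While[OF n(1)])
    show "J 0 (iupd x [] 0 s)" using n x init by (simp add: J_def unchanged_def mem_simps)
  next
    fix k s' assume k: "k < n" and J: "J k s'"
    then have "runs n ora K c s' (\<lambda>s''. I (Suc k) (iupd x [] (Suc k) s''))"
      by (intro body) (auto simp: J_def)
    then have "runs n ora K (Seq c (IAssign x [] (IAdd (ivar x) (IConst 1)))) s' (J (Suc k))"
    proof (intro runs_Seq, elim runs_conseq, intro runs_IAssign)
      fix s'' assume s'': "I (Suc k) (iupd x [] (Suc k) s'')" "unchanged c s' s''"
      then have "imem s'' x [] = k" "imem s'' ''n'' [] = n" using x J by (auto simp: J_def unchanged_def)
      then show "J (Suc k) (iupd x (map (ival s'') []) (ival s'' (IAdd (ivar x) (IConst 1))) s'')"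
        using s'' J x by (auto simp: J_def unchanged_def mem_simps)
    qed
    then show "bval s' (ILess (ivar x) (ivar ''n'')) \<and>
        runs n ora K (Seq c (IAssign x [] (IAdd (ivar x) (IConst 1)))) s' (J (Suc k))"
      using J k by (simp add: J_def)
  qed (simp add: J_def)
  then show ?thesis unfolding For_def
    by (intro runs_Seq runs_IAssign) (auto simp: J_def elim: runs_conseq)
qed

section \<open>The program\<close>

text \<open>Only the real constants 0 and 1 are available, so a numeral is a sum of ones, whose
  length is a constant of the program.\<close>

primrec rnat :: "nat \<Rightarrow> rexp" where
  "rnat 0 = RZero"
| "rnat (Suc k) = RAdd (rnat k) ROne"

primrec rpow :: "rexp \<Rightarrow> nat \<Rightarrow> rexp" where
  "rpow e 0 = ROne"
| "rpow e (Suc k) = RMul e (rpow e k)"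

lemma rval_rnat [simp]: "rval s (rnat k) = real k"
  by (induction k) auto

lemma rval_rpow [simp]: "rval s (rpow e k) = rval s e ^ k"
  by (induction k) auto

text \<open>Indices cannot be converted to reals, hence the real number \<open>n\<close> is obtained
  by counting.\<close>

definition count_elements :: com where
  "count_elements = For ''i'' (RAssign ''N'' [] (RAdd (rvar ''N'') ROne))"

lemma count_elements_runs:
  assumes "n \<le> K" "imem s ''n'' [] = n" "rmem s ''N'' [] = 0"
  shows "runs n ora K count_elements s (\<lambda>s'. rmem s' ''N'' [] = real n)"
  unfolding count_elements_def
  by (rule runs_For) (use assms in \<open>auto intro!: runs_RAssign simp: mem_simps\<close>)

text \<open>Row \<open>i\<close> of \<open>e\<close> encodes \<open>{i}\<close>; row \<open>i\<close> of \<open>b\<close> encodes first the ground set and then its part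
  without \<open>i\<close>. The starting vectors are kept in \<open>F\<close> and \<open>G\<close>.\<close>

definition start_vector :: com where
  "start_vector =
     IAssign ''e'' [ivar ''i'', ivar ''i''] (IConst 1) ;;
     Query Oracle_f ''F'' [ivar ''i''] ''e'' [ivar ''i''] ;;
     For ''k'' (IAssign ''b'' [ivar ''i'', ivar ''k''] (IConst 1)) ;;
     Query Oracle_g ''Y'' [] ''b'' [ivar ''i''] ;;
     IAssign ''b'' [ivar ''i'', ivar ''i''] (IConst 0) ;;
     Query Oracle_g ''G'' [ivar ''i''] ''b'' [ivar ''i''] ;;
     RAssign ''F'' [ivar ''i''] (RDiv (RVar ''F'' [ivar ''i'']) (rvar ''N'')) ;;
     RAssign ''G'' [ivar ''i''] (RDiv (RSub (rvar ''Y'') (RVar ''G'' [ivar ''i''])) (rvar ''N'')) ;;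
     RAssign ''p'' [ivar ''i''] (RVar ''F'' [ivar ''i'']) ;;
     RAssign ''w'' [ivar ''i''] (RVar ''G'' [ivar ''i''])"

definition start_vectors :: com where
  "start_vectors = For ''i'' start_vector"

lemma writes_start_vector [simp]:
  "iwrites start_vector = {''e'', ''b'', ''k''}"
  "rwrites start_vector = {''F'', ''Y'', ''G'', ''p'', ''w''}"
  by (auto simp: start_vector_def)

lemma start_vector_runs:
  fixes s :: state and ora :: "ora_name \<Rightarrow> nat set \<Rightarrow> real" and n k :: nat
  assumes nK: "n \<le> K" and n: "imem s ''n'' [] = n" and i: "imem s ''i'' [] = k" "k < n"
    and e: "\<And>j. imem s ''e'' [k, j] = 0"
  defines "x \<equiv> ora Oracle_f {k} / rmem s ''N'' []"
    and "y \<equiv> (ora Oracle_g {..<n} - ora Oracle_g ({..<n} - {k})) / rmem s ''N'' []"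
  shows "runs n ora K start_vector s (\<lambda>s'.
    rmem s' ''F'' = (rmem s ''F'')([k] := x) \<and> rmem s' ''G'' = (rmem s ''G'')([k] := y) \<and>
    rmem s' ''p'' = (rmem s ''p'')([k] := x) \<and> rmem s' ''w'' = (rmem s ''w'')([k] := y) \<and>
    imem s' ''e'' = (imem s ''e'')([k, k] := 1))"
proof -
  have row: "runs n ora K (For ''k'' (IAssign ''b'' [ivar ''i'', ivar ''k''] (IConst 1))) s1
      (\<lambda>s2. \<forall>l<n. imem s2 ''b'' [k, l] = 1)"
    if "imem s1 ''n'' [] = n" "imem s1 ''i'' [] = k" for s1
  proof (rule runs_For[OF nK that(1), where I = "\<lambda>m s2. \<forall>l<m. imem s2 ''b'' [k, l] = 1"])
    fix m and s2 :: state
    assume I: "\<forall>l<m. imem s2 ''b'' [k, l] = 1" and m: "imem s2 ''k'' [] = m"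
      and un: "unchanged (For ''k'' (IAssign ''b'' [ivar ''i'', ivar ''k''] (IConst 1))) s1 s2"
    have i2: "imem s2 ''i'' [] = k" using un that(2) by (simp add: unchanged_def)
    show "runs n ora K (IAssign ''b'' [ivar ''i'', ivar ''k''] (IConst 1)) s2
      (\<lambda>s3. \<forall>l<Suc m. imem (iupd ''k'' [] (Suc m) s3) ''b'' [k, l] = 1)"
      by (rule runs_IAssign) (use I in \<open>simp add: mem_simps m i2 less_Suc_eq\<close>)
  qed simp_all
  note ev = mem_simps i
  show ?thesis unfolding start_vector_def
    apply (rule runs_Seq, rule runs_IAssign, simp add: ev del: One_nat_def)
    apply (rule runs_Seq, rule runs_Query_set[where A = "{k}"])
     apply (use i(2) e in \<open>auto simp: ev\<close>)[1]
    apply (rule runs_Seq, simp add: ev del: One_nat_def, rule runs_conseq)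
     apply (rule row)
      apply (simp add: mem_simps n)
     apply (simp add: mem_simps i)
    subgoal premises prems for s1
    proof -
      have m: "imem s1 ''i'' [] = k" "imem s1 ''e'' = (imem s ''e'')([k, k] := 1)"
        using prems(2) by (simp_all add: unchanged_def mem_simps i)
      have "rmem s1 x = ((rmem s)(''F'' := (rmem s ''F'')([k] := ora Oracle_f {k}))) x" for x
        using prems(2) by (simp add: unchanged_def mem_simps)
      then have "rmem s1 = (rmem s)(''F'' := (rmem s ''F'')([k] := ora Oracle_f {k}))" by blast
      note m = m this
      note ev = mem_simps m
      show ?thesis
        apply (rule runs_Seq, rule runs_Query_set[where A = "{..<n}"])
         apply (use prems(1) in \<open>auto simp: ev\<close>)[1]
        apply (simp add: ev del: One_nat_def)
        apply (rule runs_Seq, rule runs_IAssign, simp add: ev del: One_nat_def)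
        apply (rule runs_Seq, rule runs_Query_set[where A = "{..<n} - {k}"])
         apply (use prems(1) in \<open>auto simp: ev\<close>)[1]
        apply (simp add: ev del: One_nat_def)
        apply (rule runs_Seq, rule runs_RAssign, simp add: ev del: One_nat_def)
        apply (rule runs_Seq, rule runs_RAssign, simp add: ev del: One_nat_def)
        apply (rule runs_Seq, rule runs_RAssign, simp add: ev del: One_nat_def)
        apply (rule runs_RAssign, simp add: ev)
        apply (simp add: x_def y_def)
        done
    qed
    done
qed
lemma start_vectors_runs:
  fixes s :: state
  assumes "n \<le> K" "imem s ''n'' [] = n" "\<And>is. imem s ''e'' is = 0"
  shows "runs n ora K start_vectors s (\<lambda>s'. \<forall>i<n.
    rmem s' ''F'' [i] = ora Oracle_f {i} / rmem s ''N'' [] \<and>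
    rmem s' ''G'' [i] = (ora Oracle_g {..<n} - ora Oracle_g ({..<n} - {i})) / rmem s ''N'' [] \<and>
    rmem s' ''p'' [i] = rmem s' ''F'' [i] \<and> rmem s' ''w'' [i] = rmem s' ''G'' [i])"
proof -
  \<comment> \<open>Rows of \<open>e\<close> from \<open>k\<close> on are still zero, so that
    setting one entry of row \<open>k\<close> makes it encode a singleton.\<close>
  define J where "J k s' \<longleftrightarrow> (\<forall>i<k.
    rmem s' ''F'' [i] = ora Oracle_f {i} / rmem s ''N'' [] \<and>
    rmem s' ''G'' [i] = (ora Oracle_g {..<n} - ora Oracle_g ({..<n} - {i})) / rmem s ''N'' [] \<and>
    rmem s' ''p'' [i] = rmem s' ''F'' [i] \<and> rmem s' ''w'' [i] = rmem s' ''G'' [i]) \<and>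
    (\<forall>i j. k \<le> i \<longrightarrow> imem s' ''e'' [i, j] = 0)" for k and s' :: state
  have "runs n ora K start_vectors s (J n)"
    unfolding start_vectors_def
  proof (rule runs_For[OF assms(1,2)])
    show "J 0 (iupd ''i'' [] 0 s)" using assms(3) by (simp add: J_def mem_simps)
  next
    fix k s' assume k: "k < n" and J: "J k s'" and i: "imem s' ''i'' [] = k" "imem s' ''n'' [] = n"
      and un: "unchanged (For ''i'' start_vector) s s'"
    have N: "rmem s' ''N'' = rmem s ''N''" using un by (simp add: unchanged_def)
    have "imem s' ''e'' [k, j] = 0" for j using J by (simp add: J_def)
    from start_vector_runs[OF assms(1) i(2,1) k this]
    show "runs n ora K start_vector s' (\<lambda>s''. J (Suc k) (iupd ''i'' [] (Suc k) s''))"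
      by (rule runs_conseq) (use J in \<open>auto simp: J_def mem_simps less_Suc_eq N\<close>)
  qed simp_all
  then show ?thesis by (rule runs_conseq) (auto simp: J_def)
qed

text \<open>A scan builds the search \<open>o\<close> greedily, with the visited elements marked in \<open>a\<close>. The current
  oracle values are \<open>X\<close> and \<open>Y\<close>, the previous ones \<open>x\<close> and \<open>y\<close>; \<open>q\<close> and \<open>v\<close> receive the gains of \<open>f\<close>
  and \<open>g\<close>, and \<open>c\<close> the cost. The least cost so far is \<open>z\<close> (junk while the counter \<open>t\<close> is 0).\<close>

definition ratio :: "iexp \<Rightarrow> rexp" where
  "ratio e = RDiv (RVar ''w'' [e]) (RVar ''p'' [e])"

text \<open>The value \<open>n\<close> in \<open>m\<close> means that no candidate has been found
  yet. The disjunction "no candidate, or a strictly smaller ratio" is expressed by negation and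
  conjunction.\<close>

definition pick :: com where
  "pick =
     IAssign ''m'' [] (ivar ''n'') ;;
     For ''i''
       (Cond (BAnd (ILess (IVar ''a'' [ivar ''i'']) (IConst 1))
               (BNot (BAnd (ILess (ivar ''m'') (ivar ''n''))
                           (BNot (RLess (ratio (ivar ''m'')) (ratio (ivar ''i'')))))))
          (IAssign ''m'' [] (ivar ''i'')) Skip)"

lemma writes_pick [simp]: "iwrites pick = {''m'', ''i''}" "rwrites pick = {}"
  by (auto simp: pick_def)

lemma pick_runs:
  fixes s :: state
  assumes nK: "n \<le> K" and n: "imem s ''n'' [] = n" and l: "l < n" "imem s ''a'' [l] = 0"
  defines "\<rho> \<equiv> (\<lambda>i. rmem s ''w'' [i] / rmem s ''p'' [i])"
  shows "runs n ora K pick s (\<lambda>s'. imem s' ''m'' [] < n \<and> imem s ''a'' [imem s' ''m'' []] = 0 \<and>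
    (\<forall>i<n. imem s ''a'' [i] = 0 \<longrightarrow> \<rho> i \<le> \<rho> (imem s' ''m'' [])))"
proof -
  define J where "J k s' \<longleftrightarrow>
    imem s' ''m'' [] = n \<and> (\<forall>i<k. imem s ''a'' [i] \<noteq> 0) \<or>
    imem s' ''m'' [] < n \<and> imem s ''a'' [imem s' ''m'' []] = 0 \<and>
    (\<forall>i<k. imem s ''a'' [i] = 0 \<longrightarrow> \<rho> i \<le> \<rho> (imem s' ''m'' []))" for k and s' :: state
  have "runs n ora K (For ''i''
       (Cond (BAnd (ILess (IVar ''a'' [ivar ''i'']) (IConst 1))
               (BNot (BAnd (ILess (ivar ''m'') (ivar ''n''))
                           (BNot (RLess (ratio (ivar ''m'')) (ratio (ivar ''i'')))))))
          (IAssign ''m'' [] (ivar ''i'')) Skip)) (iupd ''m'' [] n s) (J n)" (is "runs _ _ _ ?c _ _")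
  proof (rule runs_For[OF nK])
    show "J 0 (iupd ''i'' [] 0 (iupd ''m'' [] n s))" by (simp add: J_def mem_simps)
  next
    fix k and s' :: state
    assume k: "k < n" and J: "J k s'" and i: "imem s' ''i'' [] = k" and n': "imem s' ''n'' [] = n"
      and un: "unchanged ?c (iupd ''m'' [] n s) s'"
    have m: "imem s' ''a'' = imem s ''a''" "rmem s' ''p'' = rmem s ''p''" "rmem s' ''w'' = rmem s ''w''"
      using un by (simp_all add: unchanged_def mem_simps)
    show "runs n ora K
       (Cond (BAnd (ILess (IVar ''a'' [ivar ''i'']) (IConst 1))
               (BNot (BAnd (ILess (ivar ''m'') (ivar ''n''))
                           (BNot (RLess (ratio (ivar ''m'')) (ratio (ivar ''i'')))))))
          (IAssign ''m'' [] (ivar ''i'')) Skip) s' (\<lambda>s''. J (Suc k) (iupd ''i'' [] (Suc k) s''))"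
    proof (rule runs_Cond, goal_cases)
      case 1
      then have a: "imem s ''a'' [k] = 0" "imem s' ''m'' [] < n \<longrightarrow> \<rho> (imem s' ''m'' []) < \<rho> k"
        by (simp_all add: i n' m \<rho>_def ratio_def)
      show ?case
        by (rule runs_IAssign) (use J a k in \<open>fastforce simp: J_def mem_simps i less_Suc_eq\<close>)
    next
      case 2
      then have a: "imem s ''a'' [k] = 0 \<Longrightarrow> imem s' ''m'' [] < n \<and> \<rho> k \<le> \<rho> (imem s' ''m'' [])"
        by (auto simp: i n' m \<rho>_def ratio_def)
      show ?case
        by (rule runs_Skip) (use J a in \<open>auto simp: J_def mem_simps less_Suc_eq\<close>)
    qed
  qed (use n in \<open>simp_all add: mem_simps\<close>)
  moreover have "\<not> (\<forall>i<n. imem s ''a'' [i] \<noteq> 0)" using l by blast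
  ultimately show ?thesis unfolding pick_def
    by (intro runs_Seq runs_IAssign) (simp add: n, erule runs_conseq, auto simp: J_def)
qed

definition select :: com where
  "select =
     pick ;;
     IAssign ''a'' [ivar ''m''] (IConst 1) ;;
     Query Oracle_f ''X'' [] ''a'' [] ;;
     Query Oracle_g ''Y'' [] ''a'' [] ;;
     RAssign ''q'' [ivar ''m''] (RSub (rvar ''X'') (rvar ''x'')) ;;
     RAssign ''v'' [ivar ''m''] (RSub (rvar ''Y'') (rvar ''y'')) ;;
     RAssign ''c'' [] (RAdd (rvar ''c'') (RMul (RSub (rvar ''Y'') (rvar ''y'')) (rvar ''X''))) ;;
     RAssign ''x'' [] (rvar ''X'') ;;
     RAssign ''y'' [] (rvar ''Y'') ;;
     IAssign ''o'' [ivar ''k''] (ivar ''m'')"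

lemma writes_select [simp]:
  "iwrites select = {''m'', ''i'', ''a'', ''o''}"
  "rwrites select = {''X'', ''Y'', ''q'', ''v'', ''c'', ''x'', ''y''}"
  by (auto simp: select_def)

lemma select_runs:
  fixes s :: state and ora :: "ora_name \<Rightarrow> nat set \<Rightarrow> real" and n k :: nat
  assumes nK: "n \<le> K" and n: "imem s ''n'' [] = n" and k: "imem s ''k'' [] = k"
    and A: "\<forall>i<n. imem s ''a'' [i] \<noteq> 0 \<longleftrightarrow> i \<in> A" "A \<subseteq> {..<n}" "A \<noteq> {..<n}"
  defines "\<rho> \<equiv> (\<lambda>i. rmem s ''w'' [i] / rmem s ''p'' [i])"
  shows "runs n ora K select s (\<lambda>s'. \<exists>m<n. m \<notin> A \<and> (\<forall>i<n. i \<notin> A \<longrightarrow> \<rho> i \<le> \<rho> m) \<and>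
    imem s' ''a'' = (imem s ''a'')([m] := 1) \<and> imem s' ''o'' = (imem s ''o'')([k] := m) \<and>
    rmem s' ''q'' = (rmem s ''q'')([m] := ora Oracle_f (insert m A) - rmem s ''x'' []) \<and>
    rmem s' ''v'' = (rmem s ''v'')([m] := ora Oracle_g (insert m A) - rmem s ''y'' []) \<and>
    rmem s' ''c'' [] = rmem s ''c'' [] +
      (ora Oracle_g (insert m A) - rmem s ''y'' []) * ora Oracle_f (insert m A) \<and>
    rmem s' ''x'' [] = ora Oracle_f (insert m A) \<and> rmem s' ''y'' [] = ora Oracle_g (insert m A))"
proof -
  obtain l where l: "l < n" "l \<notin> A" using A(2,3) by blast
  then have al: "imem s ''a'' [l] = 0" using A(1) by blast
  show ?thesis unfolding select_def
  proof (rule runs_Seq, rule runs_conseq, rule pick_runs[OF nK n l(1) al], goal_cases)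
    case (1 s1)
    define m where "m = imem s1 ''m'' []"
    have m: "m < n" "m \<notin> A" "\<forall>i<n. i \<notin> A \<longrightarrow> \<rho> i \<le> \<rho> m"
      using 1(1) A(1) unfolding m_def \<rho>_def by blast+
    have r: "rmem s1 x = rmem s x" for x using 1(2) by (simp add: unchanged_def)
    have i: "imem s1 ''m'' [] = m" "imem s1 ''k'' [] = k" "imem s1 ''a'' = imem s ''a''" "imem s1 ''o'' = imem s ''o''"
      using 1(2) k by (simp_all add: unchanged_def m_def)
    note ev = mem_simps i r
    show ?case
      apply (rule runs_Seq, rule runs_IAssign, simp add: ev del: One_nat_def)
      apply (rule runs_Seq, rule runs_Query_set[where A = "insert m A"])
       apply (use A(1,2) m(1,2) in \<open>auto simp: ev\<close>)[1]
      apply (simp add: ev del: One_nat_def)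
      apply (rule runs_Seq, rule runs_Query_set[where A = "insert m A"])
       apply (use A(1,2) m(1,2) in \<open>auto simp: ev\<close>)[1]
      apply (simp add: ev del: One_nat_def)
      apply (rule runs_Seq, rule runs_RAssign, simp add: ev del: One_nat_def)
      apply (rule runs_Seq, rule runs_RAssign, simp add: ev del: One_nat_def)
      apply (rule runs_Seq, rule runs_RAssign, simp add: ev del: One_nat_def)
      apply (rule runs_Seq, rule runs_RAssign, simp add: ev del: One_nat_def)
      apply (rule runs_Seq, rule runs_RAssign, simp add: ev del: One_nat_def)
      apply (rule runs_IAssign)
      apply (rule exI[of _ m])
      apply (simp add: ev m)
      done
  qed
qed

definition scan :: com where
  "scan =
     For ''i'' (IAssign ''a'' [ivar ''i''] (IConst 0)) ;;
     RAssign ''x'' [] RZero ;; RAssign ''y'' [] RZero ;; RAssign ''c'' [] RZero ;;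
     For ''k'' select"

lemma writes_scan [simp]:
  "iwrites scan = {''m'', ''i'', ''k'', ''a'', ''o''}"
  "rwrites scan = {''X'', ''Y'', ''q'', ''v'', ''c'', ''x'', ''y''}"
  by (auto simp: scan_def)

lemma search_cost_snoc:
  assumes "m \<notin> set \<pi>"
  shows "search_cost (insert m (set \<pi>)) f g (\<pi> @ [m]) = search_cost (set \<pi>) f g \<pi>
    + (g (insert m (set \<pi>)) - g (set \<pi>)) * f (insert m (set \<pi>))"
proof -
  have "(\<Sum>j\<in>set \<pi>. gain g (\<pi> @ [m]) j * f (searched (\<pi> @ [m]) j)) = (\<Sum>j\<in>set \<pi>. gain g \<pi> j * f (searched \<pi> j))"
    by (intro sum.cong) (auto simp: gain_append searched_append)
  then show ?thesis using assms
    by (simp add: search_cost_gain gain_snoc searched_snoc)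
qed

lemma scan_runs:
  fixes s :: state and ora :: "ora_name \<Rightarrow> nat set \<Rightarrow> real" and n :: nat
  assumes nK: "n \<le> K" and n: "imem s ''n'' [] = n" and empty: "ora Oracle_f {} = 0" "ora Oracle_g {} = 0"
  defines "\<rho> \<equiv> (\<lambda>i. rmem s ''w'' [i] / rmem s ''p'' [i])"
  shows "runs n ora K scan s (\<lambda>s'. \<exists>\<pi>. distinct \<pi> \<and> set \<pi> = {..<n} \<and>
    sorted_wrt (\<lambda>i j. \<rho> i \<ge> \<rho> j) \<pi> \<and> (\<forall>l<n. imem s' ''o'' [l] = \<pi> ! l) \<and>
    (\<forall>j<n. rmem s' ''q'' [j] = gain (ora Oracle_f) \<pi> j \<and> rmem s' ''v'' [j] = gain (ora Oracle_g) \<pi> j) \<and>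
    rmem s' ''c'' [] = search_cost {..<n} (ora Oracle_f) (ora Oracle_g) \<pi>)"
proof -
  \<comment> \<open>Every visited ratio is at least every unvisited one; this keeps the prefix
    sorted when the next element is appended, and the maximal choice made by \<open>pick\<close>
    preserves it.\<close>
  define J where "J k s' \<longleftrightarrow> (\<exists>\<pi>. distinct \<pi> \<and> length \<pi> = k \<and> set \<pi> \<subseteq> {..<n} \<and>
    sorted_wrt (\<lambda>i j. \<rho> i \<ge> \<rho> j) \<pi> \<and> (\<forall>j\<in>set \<pi>. \<forall>i<n. i \<notin> set \<pi> \<longrightarrow> \<rho> i \<le> \<rho> j) \<and>
    (\<forall>i<n. imem s' ''a'' [i] \<noteq> 0 \<longleftrightarrow> i \<in> set \<pi>) \<and> (\<forall>l<k. imem s' ''o'' [l] = \<pi> ! l) \<and>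
    (\<forall>j\<in>set \<pi>. rmem s' ''q'' [j] = gain (ora Oracle_f) \<pi> j \<and> rmem s' ''v'' [j] = gain (ora Oracle_g) \<pi> j) \<and>
    rmem s' ''x'' [] = ora Oracle_f (set \<pi>) \<and> rmem s' ''y'' [] = ora Oracle_g (set \<pi>) \<and>
    rmem s' ''c'' [] = search_cost (set \<pi>) (ora Oracle_f) (ora Oracle_g) \<pi>)" for k and s' :: state
  have clear: "runs n ora K (For ''i'' (IAssign ''a'' [ivar ''i''] (IConst 0))) s (\<lambda>s'. \<forall>l<n. imem s' ''a'' [l] = 0)"
  proof (rule runs_For[OF nK n, where I = "\<lambda>m s'. \<forall>l<m. imem s' ''a'' [l] = 0"])
    fix m and s' :: state
    assume I: "\<forall>l<m. imem s' ''a'' [l] = 0" and m: "imem s' ''i'' [] = m"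
    show "runs n ora K (IAssign ''a'' [ivar ''i''] (IConst 0)) s'
      (\<lambda>s''. \<forall>l<Suc m. imem (iupd ''i'' [] (Suc m) s'') ''a'' [l] = 0)"
      by (rule runs_IAssign) (use I in \<open>simp add: mem_simps m less_Suc_eq\<close>)
  qed simp_all
  have loop: "runs n ora K (For ''k'' select) s1 (J n)"
    if "\<forall>l<n. imem s1 ''a'' [l] = 0" "imem s1 ''n'' [] = n" "rmem s1 ''x'' [] = 0" "rmem s1 ''y'' [] = 0"
      "rmem s1 ''c'' [] = 0" "rmem s1 ''w'' = rmem s ''w''" "rmem s1 ''p'' = rmem s ''p''" for s1 :: state
  proof (rule runs_For[OF nK that(2)])
    show "J 0 (iupd ''k'' [] 0 s1)" unfolding J_def
      by (rule exI[of _ "[]"]) (use that empty in \<open>simp add: mem_simps search_cost_def\<close>)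
  next
    fix k and s2 :: state
    assume k: "k < n" and J: "J k s2" and ik: "imem s2 ''k'' [] = k" and n2: "imem s2 ''n'' [] = n"
      and un: "unchanged (For ''k'' select) s1 s2"
    have rho: "rmem s2 ''w'' [i] / rmem s2 ''p'' [i] = \<rho> i" for i
      using un that(6,7) by (simp add: unchanged_def \<rho>_def)
    from J obtain \<pi> where \<pi>: "distinct \<pi>" "length \<pi> = k" "set \<pi> \<subseteq> {..<n}"
      "sorted_wrt (\<lambda>i j. \<rho> i \<ge> \<rho> j) \<pi>" "\<forall>j\<in>set \<pi>. \<forall>i<n. i \<notin> set \<pi> \<longrightarrow> \<rho> i \<le> \<rho> j"
      and a: "\<forall>i<n. imem s2 ''a'' [i] \<noteq> 0 \<longleftrightarrow> i \<in> set \<pi>" and o: "\<forall>l<k. imem s2 ''o'' [l] = \<pi> ! l"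
      and qv: "\<forall>j\<in>set \<pi>. rmem s2 ''q'' [j] = gain (ora Oracle_f) \<pi> j \<and> rmem s2 ''v'' [j] = gain (ora Oracle_g) \<pi> j"
      and xy: "rmem s2 ''x'' [] = ora Oracle_f (set \<pi>)" "rmem s2 ''y'' [] = ora Oracle_g (set \<pi>)"
      and c: "rmem s2 ''c'' [] = search_cost (set \<pi>) (ora Oracle_f) (ora Oracle_g) \<pi>"
      unfolding J_def by blast
    have ne: "set \<pi> \<noteq> {..<n}" using distinct_card[OF \<pi>(1)] \<pi>(2) k by (metis card_lessThan less_irrefl)
    show "runs n ora K select s2 (\<lambda>s''. J (Suc k) (iupd ''k'' [] (Suc k) s''))"
    proof (rule runs_conseq, rule select_runs[OF nK n2 ik a \<pi>(3) ne], goal_cases)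
      case (1 s3)
      then obtain m where m: "m < n" "m \<notin> set \<pi>" "\<forall>i<n. i \<notin> set \<pi> \<longrightarrow> \<rho> i \<le> \<rho> m"
        and a3: "imem s3 ''a'' = (imem s2 ''a'')([m] := 1)" and o3: "imem s3 ''o'' = (imem s2 ''o'')([k] := m)"
        and q3: "rmem s3 ''q'' = (rmem s2 ''q'')([m] := ora Oracle_f (insert m (set \<pi>)) - rmem s2 ''x'' [])"
        and v3: "rmem s3 ''v'' = (rmem s2 ''v'')([m] := ora Oracle_g (insert m (set \<pi>)) - rmem s2 ''y'' [])"
        and c3: "rmem s3 ''c'' [] = rmem s2 ''c'' [] +
          (ora Oracle_g (insert m (set \<pi>)) - rmem s2 ''y'' []) * ora Oracle_f (insert m (set \<pi>))"
        and xy3: "rmem s3 ''x'' [] = ora Oracle_f (insert m (set \<pi>))"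
          "rmem s3 ''y'' [] = ora Oracle_g (insert m (set \<pi>))"
        unfolding rho by blast
      show ?case unfolding J_def
      proof (rule exI[of _ "\<pi> @ [m]"], intro conjI)
        show "\<forall>l<Suc k. imem (iupd ''k'' [] (Suc k) s3) ''o'' [l] = (\<pi> @ [m]) ! l"
          using o \<pi>(2) by (auto simp: mem_simps o3 nth_append less_Suc_eq)
        show "\<forall>j\<in>set (\<pi> @ [m]). rmem (iupd ''k'' [] (Suc k) s3) ''q'' [j] = gain (ora Oracle_f) (\<pi> @ [m]) j \<and>
          rmem (iupd ''k'' [] (Suc k) s3) ''v'' [j] = gain (ora Oracle_g) (\<pi> @ [m]) j"
          using qv m(2) by (auto simp: mem_simps q3 v3 gain_snoc gain_append xy)
        show "rmem (iupd ''k'' [] (Suc k) s3) ''c'' []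
            = search_cost (set (\<pi> @ [m])) (ora Oracle_f) (ora Oracle_g) (\<pi> @ [m])"
          using m(2) by (simp add: mem_simps c3 c xy search_cost_snoc)
        show "sorted_wrt (\<lambda>i j. \<rho> i \<ge> \<rho> j) (\<pi> @ [m])"
          using \<pi>(4,5) m by (auto simp: sorted_wrt_append)
      qed (use \<pi> m a in \<open>auto simp: mem_simps a3 xy3\<close>)
    qed
  qed simp_all
  have "runs n ora K scan s (J n)"
    unfolding scan_def
    apply (rule runs_Seq, rule runs_conseq, rule clear)
    apply (rule runs_Seq, rule runs_RAssign, simp)
    apply (rule runs_Seq, rule runs_RAssign, simp)
    apply (rule runs_Seq, rule runs_RAssign, simp)
    apply (rule loop)
          apply (simp_all add: mem_simps unchanged_def n)
    done
  then show ?thesis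
  proof (rule runs_conseq)
    fix s' assume "J n s'"
    then obtain \<pi> where \<pi>: "distinct \<pi>" "length \<pi> = n" "set \<pi> \<subseteq> {..<n}"
      "sorted_wrt (\<lambda>i j. \<rho> i \<ge> \<rho> j) \<pi>" "\<forall>l<n. imem s' ''o'' [l] = \<pi> ! l"
      "\<forall>j\<in>set \<pi>. rmem s' ''q'' [j] = gain (ora Oracle_f) \<pi> j \<and> rmem s' ''v'' [j] = gain (ora Oracle_g) \<pi> j"
      "rmem s' ''c'' [] = search_cost (set \<pi>) (ora Oracle_f) (ora Oracle_g) \<pi>"
      unfolding J_def by blast
    moreover have "set \<pi> = {..<n}"
      using \<pi> distinct_card[of \<pi>] by (intro card_subset_eq) auto
    ultimately show "\<exists>\<pi>. distinct \<pi> \<and> set \<pi> = {..<n} \<and>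
      sorted_wrt (\<lambda>i j. \<rho> i \<ge> \<rho> j) \<pi> \<and> (\<forall>l<n. imem s' ''o'' [l] = \<pi> ! l) \<and>
      (\<forall>j<n. rmem s' ''q'' [j] = gain (ora Oracle_f) \<pi> j \<and> rmem s' ''v'' [j] = gain (ora Oracle_g) \<pi> j) \<and>
      rmem s' ''c'' [] = search_cost {..<n} (ora Oracle_f) (ora Oracle_g) \<pi>" by auto
  qed
qed

text \<open>The guard says that \<open>t\<close> is not positive or \<open>c < z\<close>: the first
  search is always stored, later ones only if strictly cheaper.\<close>

definition keep_best :: com where
  "keep_best =
     Cond (BNot (BAnd (RLess RZero (rvar ''t'')) (BNot (RLess (rvar ''c'') (rvar ''z'')))))
       (RAssign ''z'' [] (rvar ''c'') ;;
        For ''i'' (IAssign ''out'' [ivar ''i''] (IVar ''o'' [ivar ''i'']))) Skip"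

lemma writes_keep_best [simp]: "iwrites keep_best = {''i'', ''out''}" "rwrites keep_best = {''z''}"
  by (auto simp: keep_best_def)

lemma keep_best_runs:
  fixes s :: state
  assumes nK: "n \<le> K" and n: "imem s ''n'' [] = n"
  shows "runs n ora K keep_best s (\<lambda>s'. if 0 < rmem s ''t'' [] \<and> rmem s ''z'' [] \<le> rmem s ''c'' []
    then rmem s' ''z'' = rmem s ''z'' \<and> imem s' ''out'' = imem s ''out''
    else rmem s' ''z'' [] = rmem s ''c'' [] \<and> (\<forall>l<n. imem s' ''out'' [l] = imem s ''o'' [l]))"
proof -
  have copy: "runs n ora K (For ''i'' (IAssign ''out'' [ivar ''i''] (IVar ''o'' [ivar ''i'']))) s1
    (\<lambda>s'. \<forall>l<n. imem s' ''out'' [l] = imem s1 ''o'' [l])" if "imem s1 ''n'' [] = n" for s1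
  proof (rule runs_For[OF nK that, where I = "\<lambda>m s'. \<forall>l<m. imem s' ''out'' [l] = imem s1 ''o'' [l]"])
    fix m and s' :: state
    assume I: "\<forall>l<m. imem s' ''out'' [l] = imem s1 ''o'' [l]" and m: "imem s' ''i'' [] = m"
      and un: "unchanged (For ''i'' (IAssign ''out'' [ivar ''i''] (IVar ''o'' [ivar ''i'']))) s1 s'"
    have o: "imem s' ''o'' = imem s1 ''o''" using un by (simp add: unchanged_def)
    show "runs n ora K (IAssign ''out'' [ivar ''i''] (IVar ''o'' [ivar ''i''])) s'
      (\<lambda>s''. \<forall>l<Suc m. imem (iupd ''i'' [] (Suc m) s'') ''out'' [l] = imem s1 ''o'' [l])"
      by (rule runs_IAssign) (use I in \<open>simp add: mem_simps m o less_Suc_eq\<close>)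
  qed simp_all
  show ?thesis unfolding keep_best_def
  proof (rule runs_Cond)
    assume "bval s (BNot (BAnd (RLess RZero (rvar ''t'')) (BNot (RLess (rvar ''c'') (rvar ''z'')))))"
    then have c: "\<not> (0 < rmem s ''t'' [] \<and> rmem s ''z'' [] \<le> rmem s ''c'' [])" by auto
    show "runs n ora K (RAssign ''z'' [] (rvar ''c'') ;;
        For ''i'' (IAssign ''out'' [ivar ''i''] (IVar ''o'' [ivar ''i'']))) s
      (\<lambda>s'. if 0 < rmem s ''t'' [] \<and> rmem s ''z'' [] \<le> rmem s ''c'' []
        then rmem s' ''z'' = rmem s ''z'' \<and> imem s' ''out'' = imem s ''out''
        else rmem s' ''z'' [] = rmem s ''c'' [] \<and> (\<forall>l<n. imem s' ''out'' [l] = imem s ''o'' [l]))"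
      unfolding if_not_P[OF c]
      by (rule runs_Seq, rule runs_RAssign, rule runs_conseq, rule copy)
        (simp_all add: n mem_simps unchanged_def)
  qed (rule runs_Skip, auto)
qed

definition rate_exp :: rexp where
  "rate_exp = RDiv ROne (RMul (rnat 65536) (rpow (rvar ''N'') 5))"

definition mix_exp :: rexp where
  "mix_exp = RDiv ROne (RMul (rnat 256) (rpow (rvar ''N'') 2))"

definition step_exp :: "vname \<Rightarrow> vname \<Rightarrow> vname \<Rightarrow> rexp" where
  "step_exp x y z = RAdd (RMul (RSub ROne rate_exp) (RVar x [ivar ''i'']))
     (RMul rate_exp (RAdd (RMul (RSub ROne mix_exp) (RVar y [ivar ''i'']))
       (RMul mix_exp (RVar z [ivar ''i'']))))"

lemma rval_step_exp:
  "rval s (step_exp x y z) = (1 - 1 / (65536 * rmem s ''N'' [] ^ 5)) * rmem s x [imem s ''i'' []] +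
    1 / (65536 * rmem s ''N'' [] ^ 5) * ((1 - 1 / (256 * rmem s ''N'' [] ^ 2)) * rmem s y [imem s ''i'' []]
      + 1 / (256 * rmem s ''N'' [] ^ 2) * rmem s z [imem s ''i'' []])"
  unfolding step_exp_def rate_exp_def mix_exp_def by (simp only: rval.simps rval_rnat rval_rpow ival.simps list.map)
    simp

definition update :: com where
  "update = For ''i''
     (RAssign ''p'' [ivar ''i''] (step_exp ''p'' ''q'' ''F'') ;;
      RAssign ''w'' [ivar ''i''] (step_exp ''w'' ''v'' ''G''))"

lemma writes_update [simp]: "iwrites update = {''i''}" "rwrites update = {''p'', ''w''}"
  by (auto simp: update_def)

lemma update_runs:
  fixes s :: state and n :: nat
  assumes nK: "n \<le> K" and n: "imem s ''n'' [] = n"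
  defines "upd \<equiv> \<lambda>x y z i. (1 - 1 / (65536 * rmem s ''N'' [] ^ 5)) * rmem s x [i] +
    1 / (65536 * rmem s ''N'' [] ^ 5) * ((1 - 1 / (256 * rmem s ''N'' [] ^ 2)) * rmem s y [i]
      + 1 / (256 * rmem s ''N'' [] ^ 2) * rmem s z [i])"
  shows "runs n ora K update s (\<lambda>s'. \<forall>i<n. rmem s' ''p'' [i] = upd ''p'' ''q'' ''F'' i \<and>
    rmem s' ''w'' [i] = upd ''w'' ''v'' ''G'' i)"
proof -
  \<comment> \<open>The arrays are overwritten in place, so the invariant also records that entries
    not yet reached have their old values.\<close>
  define J where "J k s' \<longleftrightarrow> (\<forall>i. rmem s' ''p'' [i] = (if i < k then upd ''p'' ''q'' ''F'' i else rmem s ''p'' [i]) \<and>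
    rmem s' ''w'' [i] = (if i < k then upd ''w'' ''v'' ''G'' i else rmem s ''w'' [i]))" for k and s' :: state
  have "runs n ora K update s (J n)" unfolding update_def
  proof (rule runs_For[OF nK n])
    show "J 0 (iupd ''i'' [] 0 s)" by (simp add: J_def mem_simps)
  next
    fix k and s' :: state
    assume k: "k < n" and J: "J k s'" and i: "imem s' ''i'' [] = k"
      and un: "unchanged (For ''i''
     (RAssign ''p'' [ivar ''i''] (step_exp ''p'' ''q'' ''F'') ;;
      RAssign ''w'' [ivar ''i''] (step_exp ''w'' ''v'' ''G''))) s s'"
    have m: "rmem s' ''N'' = rmem s ''N''" "rmem s' ''q'' = rmem s ''q''" "rmem s' ''v'' = rmem s ''v''"
      "rmem s' ''F'' = rmem s ''F''" "rmem s' ''G'' = rmem s ''G''"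
      using un by (simp_all add: unchanged_def)
    have 1: "rval s' (step_exp ''p'' ''q'' ''F'') = upd ''p'' ''q'' ''F'' k"
      using J by (simp add: rval_step_exp i m J_def upd_def)
    have 2: "rval (rupd ''p'' [k] x s') (step_exp ''w'' ''v'' ''G'') = upd ''w'' ''v'' ''G'' k" for x
      using J by (simp add: rval_step_exp i m J_def upd_def mem_simps)
    have ik: "ival (rupd ''p'' [k] x s') (ivar ''i'') = k" "ival s' (ivar ''i'') = k" for x
      by (simp_all add: mem_simps i)
    have 3: "rmem s' ''p'' [i] = (if i < k then upd ''p'' ''q'' ''F'' i else rmem s ''p'' [i])"
      "rmem s' ''w'' [i] = (if i < k then upd ''w'' ''v'' ''G'' i else rmem s ''w'' [i])" for i
      using J unfolding J_def by blast+
    show "runs n ora K (RAssign ''p'' [ivar ''i''] (step_exp ''p'' ''q'' ''F'') ;;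
      RAssign ''w'' [ivar ''i''] (step_exp ''w'' ''v'' ''G'')) s' (\<lambda>s''. J (Suc k) (iupd ''i'' [] (Suc k) s''))"
      apply (rule runs_Seq, rule runs_RAssign, simp only: list.map ik 1, rule runs_RAssign)
      apply (simp only: list.map ik 2)
      apply (simp add: J_def mem_simps 3 less_Suc_eq)
      done
  qed simp_all
  then show ?thesis by (rule runs_conseq) (simp add: J_def)
qed

definition iteration :: com where
  "iteration = scan ;; keep_best ;; update ;; RAssign ''t'' [] (RAdd (rvar ''t'') ROne)"

text \<open>Memory is initially zero, which provides the starting values of \<open>N\<close>,
  \<open>t\<close> and \<open>e\<close>.\<close>

definition two_approx_program :: com where
  "two_approx_program =
     count_elements ;;
     start_vectors ;;
     While (RLess (rvar ''t'') (RMul (rnat (2 ^ 24)) (rpow (rvar ''N'') 8))) iteration"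

section \<open>Analysis of the main loop\<close>

context search_instance
begin

text \<open>Program arrays agree with the mathematical vectors only at the positions in
  \<open>S\<close>.\<close>

lemma feasible_cong:
  assumes "\<And>i. i \<in> S \<Longrightarrow> p i = p' i" "\<And>i. i \<in> S \<Longrightarrow> w i = w' i"
  shows "feasible p w \<longleftrightarrow> feasible p' w'"
proof -
  have "sum p A = sum p' A" "sum w A = sum w' A" if "A \<subseteq> S" for A
    using that assms by (auto intro!: sum.cong)
  then show ?thesis using assms unfolding feasible_def independent_def by auto
qed

lemma potential_cong:
  assumes "\<And>i. i \<in> S \<Longrightarrow> p i = p' i" "\<And>i. i \<in> S \<Longrightarrow> w i = w' i"
  shows "potential S p w = potential S p' w'"
  using assms unfolding potential_def by simp

definition growth :: real where "growth = 1 + 1 / (2 ^ 24 * n ^ 7)"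

text \<open>A property of a cost value rather than of a search, so that it applies to the stored
  \<open>z\<close> and passes to smaller values.\<close>

definition two_approx :: "real \<Rightarrow> bool" where
  "two_approx z \<longleftrightarrow> (\<forall>\<sigma>\<in>permutations_of_set S. z \<le> 2 * search_cost S f g \<sigma>)"

text \<open>Bernoulli's inequality: \<open>2^24 * n^8\<close> increments of
  \<open>1 / (2^24 * n^7)\<close> add up to \<open>n\<close>, giving a power of at least
  \<open>1 + n\<close>.\<close>

lemma growth_unbounded: "n < growth ^ (2 ^ 24 * card S ^ 8)"
proof -
  have "1 + real (2 ^ 24 * card S ^ 8) * (1 / (2 ^ 24 * n ^ 7)) \<le> growth ^ (2 ^ 24 * card S ^ 8)"
    unfolding growth_def using n_ge_1 by (intro Bernoulli_inequality) (simp add: order_trans[of _ 0])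
  also have "real (2 ^ 24 * card S ^ 8) * (1 / (2 ^ 24 * n ^ 7)) = n"
    using n_ge_1 by (simp add: power_eq_if)
  finally show ?thesis by simp
qed

end

locale oracle_instance = search_instance "{..<m}" "ora Oracle_f" "ora Oracle_g"
  for m :: nat and ora :: "ora_name \<Rightarrow> nat set \<Rightarrow> real"
begin

abbreviation cost :: "nat list \<Rightarrow> real" where
  "cost \<equiv> search_cost {..<m} (ora Oracle_f) (ora Oracle_g)"

text \<open>The last clause is the alternative of the analysis: either the stored search is already
  good enough or every round so far has multiplied the potential by \<open>growth\<close>. The
  conditions \<open>0 < t\<close> exclude the initial junk in \<open>z\<close> and
  \<open>out\<close>.\<close>

definition invariant :: "nat \<Rightarrow> state \<Rightarrow> bool" where
  "invariant t s \<longleftrightarrow>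
     imem s ''n'' [] = m \<and> rmem s ''t'' [] = real t \<and> rmem s ''N'' [] = real m \<and>
     (\<forall>i<m. rmem s ''F'' [i] = p0 i \<and> rmem s ''G'' [i] = w0 i) \<and>
     feasible (\<lambda>i. rmem s ''p'' [i]) (\<lambda>i. rmem s ''w'' [i]) \<and>
     (0 < t \<longrightarrow> (\<exists>\<pi>\<in>permutations_of_set {..<m}. (\<forall>l<m. imem s ''out'' [l] = \<pi> ! l) \<and>
        rmem s ''z'' [] = cost \<pi>)) \<and>
     (0 < t \<and> two_approx (rmem s ''z'' []) \<or>
      growth ^ t * potential {..<m} p0 w0 \<le> potential {..<m} (\<lambda>i. rmem s ''p'' [i]) (\<lambda>i. rmem s ''w'' [i]))"

lemma iteration_runs:
  assumes mK: "m \<le> K" and inv: "invariant t s"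
  shows "runs m ora K iteration s (invariant (Suc t))"
proof -
  define p w where "p i = rmem s ''p'' [i]" and "w i = rmem s ''w'' [i]" for i
  have n: "imem s ''n'' [] = m" and t: "rmem s ''t'' [] = real t" and N: "rmem s ''N'' [] = real m"
    and FG: "\<forall>i<m. rmem s ''F'' [i] = p0 i \<and> rmem s ''G'' [i] = w0 i"
    and feas: "feasible p w"
    and best: "0 < t \<longrightarrow> (\<exists>\<pi>\<in>permutations_of_set {..<m}. (\<forall>l<m. imem s ''out'' [l] = \<pi> ! l) \<and>
        rmem s ''z'' [] = cost \<pi>)"
    and good: "0 < t \<and> two_approx (rmem s ''z'' []) \<or>
      growth ^ t * potential {..<m} p0 w0 \<le> potential {..<m} p w"
    using inv unfolding invariant_def p_def w_def by blast+
  show ?thesis unfolding iteration_def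
  proof (rule runs_Seq, rule runs_conseq, rule scan_runs[where ora = ora, OF mK n f_empty g_empty], goal_cases)
    case (1 s1)
    then obtain \<pi> where \<pi>: "distinct \<pi>" "set \<pi> = {..<m}" "sorted_wrt (\<lambda>i j. w i / p i \<ge> w j / p j) \<pi>"
      and o: "\<forall>l<m. imem s1 ''o'' [l] = \<pi> ! l"
      and qv: "\<forall>j<m. rmem s1 ''q'' [j] = gain (ora Oracle_f) \<pi> j \<and> rmem s1 ''v'' [j] = gain (ora Oracle_g) \<pi> j"
      and c: "rmem s1 ''c'' [] = cost \<pi>"
      unfolding p_def w_def by blast
    have \<pi>_perm: "\<pi> \<in> permutations_of_set {..<m}" using \<pi> by (simp add: permutations_of_set_def)
    have s1: "imem s1 ''n'' = imem s ''n''" "imem s1 ''out'' = imem s ''out''" "rmem s1 ''t'' = rmem s ''t''"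
      "rmem s1 ''N'' = rmem s ''N''" "rmem s1 ''F'' = rmem s ''F''" "rmem s1 ''G'' = rmem s ''G''"
      "rmem s1 ''p'' = rmem s ''p''" "rmem s1 ''w'' = rmem s ''w''" "rmem s1 ''z'' = rmem s ''z''"
      using 1(2) by (simp_all add: unchanged_def)
    have n1: "imem s1 ''n'' [] = m" using s1 n by simp
    show ?case
    proof (rule runs_Seq, rule runs_conseq, rule keep_best_runs[OF mK n1], goal_cases)
      case (1 s2)
      have s2: "imem s2 ''n'' = imem s1 ''n''" "rmem s2 ''t'' = rmem s1 ''t''"
        "rmem s2 ''N'' = rmem s1 ''N''" "rmem s2 ''F'' = rmem s1 ''F''" "rmem s2 ''G'' = rmem s1 ''G''"
        "rmem s2 ''p'' = rmem s1 ''p''" "rmem s2 ''w'' = rmem s1 ''w''"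
        "rmem s2 ''q'' = rmem s1 ''q''" "rmem s2 ''v'' = rmem s1 ''v''"
        using 1(2) by (simp_all add: unchanged_def)
      have n2: "imem s2 ''n'' [] = m" using s2 n1 by simp
      \<comment> \<open>The stored cost exceeds neither the new cost nor the previous stored cost,
        so a 2-approximation is never lost.\<close>
      have z_le: "rmem s2 ''z'' [] \<le> cost \<pi>"
        and z_le': "0 < t \<longrightarrow> rmem s2 ''z'' [] \<le> rmem s ''z'' []"
        and best2: "\<exists>\<pi>\<in>permutations_of_set {..<m}. (\<forall>l<m. imem s2 ''out'' [l] = \<pi> ! l) \<and>
          rmem s2 ''z'' [] = cost \<pi>"
        using 1(1) best \<pi>_perm o unfolding s1 t c by (auto split: if_splits)
      show ?case
      proof (rule runs_Seq, rule runs_conseq, rule update_runs[OF mK n2], goal_cases)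
        case (1 s3)
        have s3: "imem s3 ''n'' = imem s2 ''n''" "imem s3 ''out'' = imem s2 ''out''" "rmem s3 ''t'' = rmem s2 ''t''"
          "rmem s3 ''N'' = rmem s2 ''N''" "rmem s3 ''F'' = rmem s2 ''F''" "rmem s3 ''G'' = rmem s2 ''G''"
          "rmem s3 ''z'' = rmem s2 ''z''"
          using 1(2) by (simp_all add: unchanged_def)
        have pw3: "rmem s3 ''p'' [i] = step (ora Oracle_f) p0 \<pi> p i"
          "rmem s3 ''w'' [i] = step (ora Oracle_g) w0 \<pi> w i" if "i \<in> {..<m}" for i
          using 1(1) that FG qv N unfolding s2 s1 step_def rate_def mix_def p_def w_def by simp_all
        have feas3: "feasible (\<lambda>i. rmem s3 ''p'' [i]) (\<lambda>i. rmem s3 ''w'' [i])"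
          by (subst feasible_cong, rule pw3, assumption, rule pw3, assumption)
            (rule feasible_step[OF feas \<pi>(1,2)])
        have pot3: "potential {..<m} (\<lambda>i. rmem s3 ''p'' [i]) (\<lambda>i. rmem s3 ''w'' [i])
            = potential {..<m} (step (ora Oracle_f) p0 \<pi> p) (step (ora Oracle_g) w0 \<pi> w)"
          by (rule potential_cong) (use pw3 in auto)
        have good3: "two_approx (rmem s2 ''z'' []) \<or>
          growth ^ Suc t * potential {..<m} p0 w0 \<le>
            potential {..<m} (\<lambda>i. rmem s3 ''p'' [i]) (\<lambda>i. rmem s3 ''w'' [i])"
        proof (cases "two_approx (rmem s2 ''z'' [])")
          case False
          \<comment> \<open>If the stored cost is still too large, so were the new search and the
            old stored one; hence the potential grew in this round and in all earlier ones.\<close>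
          then have "\<not> two_approx (cost \<pi>)" "\<not> (0 < t \<and> two_approx (rmem s ''z'' []))"
            using z_le z_le' unfolding two_approx_def by (meson order_trans)+
          then have old: "growth ^ t * potential {..<m} p0 w0 \<le> potential {..<m} p w"
            and new: "growth * potential {..<m} p w \<le>
              potential {..<m} (step (ora Oracle_f) p0 \<pi> p) (step (ora Oracle_g) w0 \<pi> w)"
            using good two_approx_or_growth[OF feas \<pi>] unfolding two_approx_def growth_def by blast+
          have "0 \<le> growth" unfolding growth_def by simp
          then have "growth * (growth ^ t * potential {..<m} p0 w0) \<le> growth * potential {..<m} p w"
            using old by (rule mult_left_mono[rotated])
          then show ?thesis using new unfolding pot3 by (simp add: mult.assoc)
        qed simp
        show ?case
          by (rule runs_RAssign)
            (use feas3 good3 best2 n2 FG N t in \<open>simp add: invariant_def mem_simps s1 s2 s3\<close>)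
      qed
    qed
  qed
qed

text \<open>The number \<open>K\<close> of rounds of the main loop also bounds the inner loops,
  since \<open>m \<le> m^8\<close> for positive \<open>m\<close>.\<close>

lemma program_runs:
  assumes K: "K = 2 ^ 24 * m ^ 8"
  shows "runs m ora K two_approx_program (init_state m) (\<lambda>s. \<exists>\<pi>\<in>permutations_of_set {..<m}.
    (\<forall>l<m. imem s ''out'' [l] = \<pi> ! l) \<and> two_approx (cost \<pi>))"
proof -
  have m1: "1 \<le> m" using nonempty by (simp add: lessThan_empty_iff Suc_le_eq)
  have mK: "m \<le> K"
  proof -
    have "m * 1 \<le> m ^ 8" using self_le_power[of m 8] m1 by simp
    then show ?thesis unfolding K by simp
  qed
  have loop: "runs m ora K (While (RLess (rvar ''t'') (RMul (rnat (2 ^ 24)) (rpow (rvar ''N'') 8))) iteration)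
      s (invariant K)" if "invariant 0 s" for s
  proof (rule runs_While[where I = invariant, OF order_refl that])
    have guard: "bval s (RLess (rvar ''t'') (RMul (rnat (2 ^ 24)) (rpow (rvar ''N'') 8))) \<longleftrightarrow> t < K"
      if "invariant t s" for t s
    proof -
      have "bval s (RLess (rvar ''t'') (RMul (rnat (2 ^ 24)) (rpow (rvar ''N'') 8)))
          \<longleftrightarrow> real t < real (2 ^ 24) * real m ^ 8"
        using that unfolding invariant_def by (simp only: bval.simps rval.simps rval_rnat rval_rpow list.map)
      also have "\<dots> \<longleftrightarrow> t < K" unfolding K by (simp only: of_nat_less_iff flip: of_nat_mult of_nat_power)
      finally show ?thesis .
    qed
    show "bval s' (RLess (rvar ''t'') (RMul (rnat (2 ^ 24)) (rpow (rvar ''N'') 8))) \<and>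
        runs m ora K iteration s' (invariant (Suc k))" if "k < K" "invariant k s'" for k s'
      using guard[OF that(2)] that iteration_runs[OF mK] by blast
    show "\<not> bval s' (RLess (rvar ''t'') (RMul (rnat (2 ^ 24)) (rpow (rvar ''N'') 8)))"
      if "invariant K s'" for s' using guard[OF that] by blast
  qed
  have final: "\<exists>\<pi>\<in>permutations_of_set {..<m}. (\<forall>l<m. imem s ''out'' [l] = \<pi> ! l) \<and> two_approx (cost \<pi>)"
    if inv: "invariant K s" for s
  proof -
    define p w where "p i = rmem s ''p'' [i]" and "w i = rmem s ''w'' [i]" for i
    have "0 < K" using m1 unfolding K by simp
    then obtain \<pi> where \<pi>: "\<pi> \<in> permutations_of_set {..<m}" "\<forall>l<m. imem s ''out'' [l] = \<pi> ! l"
        "rmem s ''z'' [] = cost \<pi>"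
      and good: "two_approx (rmem s ''z'' []) \<or>
        growth ^ K * potential {..<m} p0 w0 \<le> potential {..<m} p w"
      and feas: "feasible p w"
      using inv unfolding invariant_def p_def w_def by blast
    \<comment> \<open>The potential of a feasible pair is at most \<open>n\<close> times its
      starting value, while \<open>growth ^ K\<close> exceeds \<open>n\<close>. This rules out the
      growth alternative of the invariant.\<close>
    have "potential {..<m} p w < growth ^ K * potential {..<m} p0 w0"
      using potential_le[OF feas] mult_strict_right_mono[OF growth_unbounded potential_start_pos] K by simp
    then have "two_approx (cost \<pi>)" using good \<pi>(3) by simp
    then show ?thesis using \<pi> by blast
  qed
  show ?thesis unfolding two_approx_program_def
  proof (rule runs_Seq, rule runs_conseq, rule count_elements_runs[OF mK], goal_cases)
    case (3 s1)
    have s1: "imem s1 ''n'' [] = m" "\<And>is. imem s1 ''e'' is = 0" "rmem s1 ''t'' [] = 0"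
      using 3(2) by (simp_all add: unchanged_def count_elements_def init_state_def)
    show ?case
    proof (rule runs_Seq, rule runs_conseq, rule start_vectors_runs[OF mK s1(1,2)], goal_cases)
      case (1 s2)
      have s2: "imem s2 ''n'' [] = m" "rmem s2 ''t'' [] = 0" "rmem s2 ''N'' [] = real m"
        using 1(2) s1 3(1) by (simp_all add: unchanged_def start_vectors_def)
      have FG: "rmem s2 ''F'' [i] = p0 i" "rmem s2 ''G'' [i] = w0 i" "rmem s2 ''p'' [i] = p0 i"
        "rmem s2 ''w'' [i] = w0 i" if "i \<in> {..<m}" for i
        using 1(1) that unfolding p0_def w0_def 3(1) by simp_all
      have "feasible (\<lambda>i. rmem s2 ''p'' [i]) (\<lambda>i. rmem s2 ''w'' [i])"
        by (subst feasible_cong, rule FG, assumption, rule FG, assumption) (rule feasible_start)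
      moreover have "potential {..<m} (\<lambda>i. rmem s2 ''p'' [i]) (\<lambda>i. rmem s2 ''w'' [i]) = potential {..<m} p0 w0"
        by (rule potential_cong) (use FG in auto)
      ultimately have "invariant 0 s2" unfolding invariant_def using s2 FG by simp
      then show ?case by (rule runs_conseq[OF loop final])
    qed
  qed (simp_all add: init_state_def)
qed

end

section \<open>Transfer from positions to an arbitrary ground set\<close>

lemma searched_map:
  assumes "inj_on h (insert j (set \<pi>))"
  shows "searched (map h \<pi>) (h j) = h ` searched \<pi> j"
proof -
  have "takeWhile (\<lambda>i. i \<noteq> h j) (map h \<pi>) = map h (takeWhile (\<lambda>i. i \<noteq> j) \<pi>)"
    unfolding takeWhile_map comp_def using assms
    by (intro arg_cong[of _ _ "map h"] takeWhile_cong) (auto simp: inj_on_def)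
  then show ?thesis unfolding searched_def by simp
qed

lemma search_cost_map:
  assumes "inj_on h T" "set \<pi> = T"
  shows "search_cost (h ` T) f g (map h \<pi>) = search_cost T (\<lambda>A. f (h ` A)) (\<lambda>A. g (h ` A)) \<pi>"
proof -
  have s: "searched (map h \<pi>) (h j) = h ` searched \<pi> j" if "j \<in> T" for j
    using assms that by (intro searched_map) (simp add: insert_absorb)
  have d: "h ` searched \<pi> j - {h j} = h ` (searched \<pi> j - {j})" if "j \<in> T" for j
    using inj_on_image_set_diff[OF assms(1), of "searched \<pi> j" "{j}"] searched_subset[of j \<pi>] assms(2) that by auto
  show ?thesis unfolding search_cost_def sum.reindex[OF assms(1)] comp_def
    by (intro sum.cong refl) (simp add: s d)
qed

lemma search_instance_image:
  assumes "inj_on h T" "search_instance (h ` T) f g"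
  shows "search_instance T (\<lambda>A. f (h ` A)) (\<lambda>A. g (h ` A))"
proof -
  interpret search_instance "h ` T" f g by fact
  have I: "h ` (A \<inter> B) = h ` A \<inter> h ` B" if "A \<subseteq> T" "B \<subseteq> T" for A B
    using inj_on_image_Int[OF assms(1) that] .
  show ?thesis
  proof
    show "finite T" using finite_S assms(1) finite_image_iff by blast
    show "T \<noteq> {}" using nonempty by blast
    show "mono_on (Pow T) (\<lambda>A. f (h ` A))" "mono_on (Pow T) (\<lambda>A. g (h ` A))"
      using f_mono g_mono by (auto simp: mono_on_def image_mono)
    show "submodular_on T (\<lambda>A. f (h ` A))"
      using f_submodular I unfolding submodular_on_def by (metis image_Un image_mono)
    show "supermodular_on T (\<lambda>A. g (h ` A))"
      using g_supermodular I unfolding supermodular_on_def by (metis image_Un image_mono)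
    show "0 < f (h ` {i})" if "i \<in> T" for i using f_pos that by simp
    show "g (h ` (T - {i})) < g (h ` T)" if "i \<in> T" for i
      using g_less[of "h i"] that inj_on_image_set_diff[OF assms(1), of T "{i}"] by simp
  qed (simp_all add: f_empty g_empty)
qed

theorem theorem2:
  "\<exists>(P :: com) (p :: nat poly).
     \<forall>(S :: 'a set) (f :: 'a set \<Rightarrow> real) (g :: 'a set \<Rightarrow> real) (xs :: 'a list).
       finite S \<longrightarrow> S \<noteq> {} \<longrightarrow>
       (\<forall>A. A \<subseteq> S \<longrightarrow> 0 \<le> f A) \<longrightarrow> mono_on (Pow S) f \<longrightarrow> submodular_on S f \<longrightarrow>
       f {} = 0 \<longrightarrow> (\<forall>A. A \<subseteq> S \<longrightarrow> A \<noteq> {} \<longrightarrow> 0 < f A) \<longrightarrow>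
       (\<forall>A. A \<subseteq> S \<longrightarrow> 0 \<le> g A) \<longrightarrow> mono_on (Pow S) g \<longrightarrow> supermodular_on S g \<longrightarrow>
       g {} = 0 \<longrightarrow> (\<forall>A. A \<subseteq> S \<longrightarrow> A \<noteq> S \<longrightarrow> g A < g S) \<longrightarrow>
       xs \<in> permutations_of_set S \<longrightarrow>
       (\<exists>t \<pi>. computes_in_time P xs f g t \<pi> \<and> t \<le> poly p (card S) \<and>
          \<pi> \<in> permutations_of_set S \<and>
          search_cost S f g \<pi> \<le> 2 * Min (search_cost S f g ` permutations_of_set S))"
proof -
  obtain p where p: "\<And>K. time_bound K two_approx_program = poly p K"
    using time_bound_poly by blast
  show ?thesis
  \<comment> \<open>The running time is a polynomial in the loop bound \<open>K\<close>, and
    \<open>K\<close> is \<open>2^24\<close> times the eighth power of \<open>card S\<close>;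
    composing the two gives the witness.\<close>
  proof (rule exI[of _ two_approx_program], rule exI[of _ "pcompose p (monom (2 ^ 24) 8)"], intro allI impI)
    fix S :: "'a set" and f g :: "'a set \<Rightarrow> real" and xs :: "'a list"
    assume S: "finite S" "S \<noteq> {}"
      and f: "\<forall>A. A \<subseteq> S \<longrightarrow> 0 \<le> f A" "mono_on (Pow S) f" "submodular_on S f" "f {} = 0"
        "\<forall>A. A \<subseteq> S \<longrightarrow> A \<noteq> {} \<longrightarrow> 0 < f A"
      and g: "\<forall>A. A \<subseteq> S \<longrightarrow> 0 \<le> g A" "mono_on (Pow S) g" "supermodular_on S g" "g {} = 0"
        "\<forall>A. A \<subseteq> S \<longrightarrow> A \<noteq> S \<longrightarrow> g A < g S"
      and xs: "xs \<in> permutations_of_set S"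
    define m where "m = length xs"
    have dxs: "distinct xs" "set xs = S" using xs by (auto simp: permutations_of_set_def)
    have m: "m = card S" unfolding m_def using distinct_card dxs by metis
    define h where "h = (!) xs"
    have inj: "inj_on h {..<m}" unfolding h_def m_def using dxs(1) by (simp add: inj_on_nth)
    have img: "h ` {..<m} = S" unfolding h_def m_def using dxs(2) by (auto simp: set_conv_nth)
    have "search_instance S f g"
    proof (rule search_instance.intro)
      show "0 < f {i}" if "i \<in> S" for i using f(5) that by simp
      show "g (S - {i}) < g S" if "i \<in> S" for i
      proof -
        have "S - {i} \<subseteq> S" "S - {i} \<noteq> S" using that by auto
        then show ?thesis using g(5) by blast
      qed
    qed (fact S f g)+
    then have "search_instance {..<m} (\<lambda>A. f (h ` A)) (\<lambda>A. g (h ` A))"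
      using search_instance_image[OF inj] img by simp
    moreover have ora: "ora_of xs f g Oracle_f = (\<lambda>A. f (h ` A))" "ora_of xs f g Oracle_g = (\<lambda>A. g (h ` A))"
      by (auto simp: ora_of_def h_def)
    ultimately interpret oracle_instance m "ora_of xs f g"
      unfolding oracle_instance_def by simp
    obtain t s \<rho> where run: "exec m (ora_of xs f g) two_approx_program (init_state m) t s"
      "t \<le> time_bound (2 ^ 24 * m ^ 8) two_approx_program"
      and \<rho>: "\<rho> \<in> permutations_of_set {..<m}" "\<forall>l<m. imem s ''out'' [l] = \<rho> ! l" "two_approx (cost \<rho>)"
      using program_runs[OF refl] unfolding runs_def by blast
    have d\<rho>: "distinct \<rho>" "set \<rho> = {..<m}" "length \<rho> = m"
      using \<rho>(1) distinct_card[of \<rho>] by (auto simp: permutations_of_set_def)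
    define \<pi> where "\<pi> = map h \<rho>"
    have cost_map: "search_cost S f g (map h \<sigma>) = cost \<sigma>" if "set \<sigma> = {..<m}" for \<sigma>
      using search_cost_map[OF inj that, of f g] unfolding img ora .
    have \<pi>: "\<pi> \<in> permutations_of_set S"
      unfolding \<pi>_def permutations_of_set_def using d\<rho> inj img by (auto simp: distinct_map)
    have "search_cost S f g \<pi> \<le> 2 * search_cost S f g \<sigma>" if "\<sigma> \<in> permutations_of_set S" for \<sigma>
    proof -
      have \<sigma>: "distinct \<sigma>" "set \<sigma> = S" using that by (auto simp: permutations_of_set_def)
      \<comment> \<open>Competing searches of \<open>S\<close> are pulled back to positions, where
        the guarantee of the program holds.\<close>
      define \<sigma>' where "\<sigma>' = map (the_inv_into {..<m} h) \<sigma>"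
      have "map h \<sigma>' = \<sigma>" unfolding \<sigma>'_def map_map
        by (intro map_idI) (use \<sigma> img f_the_inv_into_f[OF inj] in auto)
      moreover have "\<sigma>' \<in> permutations_of_set {..<m}"
        unfolding \<sigma>'_def permutations_of_set_def
        using \<sigma> img inj inj_on_the_inv_into[OF inj] the_inv_into_onto[OF inj] by (simp add: distinct_map)
      ultimately show ?thesis using \<rho>(3) cost_map d\<rho>(2) unfolding two_approx_def \<pi>_def
        by (metis permutations_of_setD(1))
    qed
    \<comment> \<open>The minimum is attained: there are finitely many searches, and
      \<open>xs\<close> is one of them.\<close>
    moreover obtain \<sigma> where "\<sigma> \<in> permutations_of_set S"
      "search_cost S f g \<sigma> = Min (search_cost S f g ` permutations_of_set S)"
      using Min_in[of "search_cost S f g ` permutations_of_set S"] xs S(1)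
      by (auto simp: image_iff)
    ultimately have approx: "search_cost S f g \<pi> \<le> 2 * Min (search_cost S f g ` permutations_of_set S)"
      by metis
    have "imem s ''out'' [k] < m" if "k < m" for k
      using that \<rho>(2) d\<rho> nth_mem[of k \<rho>] by auto
    moreover have "\<pi> = map (\<lambda>k. xs ! imem s ''out'' [k]) [0..<m]"
      unfolding \<pi>_def h_def using \<rho>(2) d\<rho>(3) by (intro nth_equalityI) auto
    ultimately have "computes_in_time two_approx_program xs f g t \<pi>"
      unfolding computes_in_time_def using run(1) m_def by blast
    moreover have "t \<le> poly (pcompose p (monom (2 ^ 24) 8)) (card S)"
      using run(2) by (simp add: p poly_pcompose poly_monom m)
    ultimately show "\<exists>t \<pi>. computes_in_time two_approx_program xs f g t \<pi> \<and>
        t \<le> poly (pcompose p (monom (2 ^ 24) 8)) (card S) \<and> \<pi> \<in> permutations_of_set S \<and>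
        search_cost S f g \<pi> \<le> 2 * Min (search_cost S f g ` permutations_of_set S)"
      using \<pi> approx by blast
  qed
qed

end
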